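(* Let $H$ and $B$ be conjugate harmonic functions of $(x^1,x^2)$ and let $\mathcal{E}_p$, $H_p=\mathrm{Re}\,\mathcal{E}_p$, $B_p=\mathrm{Im}\,\mathcal{E}_p$ and $\mathcal{F}_{2n-1}$ be defined from $\mathcal{E}_1=H+iB$ as in the context. Outside the singularities of these functions, the following eleven-dimensional metrics solve the vacuum Einstein equations. (i) (KK-wave sequence, level $6n'$) For every integer $n'>0$: $$ds^2=\mathcal{F}_{2n'-1}\bar{\mathcal{F}}_{2n'-1}\big[(dx^1)^2+(dx^2)^2\big]+(-1)^{n'}H_{2n'}^{-1}(dx^3)^2+\big[(dx^4)^2+\dots+(dx^{10})^2\big]+(-1)^{n'+1}H_{2n'}\Big[dx^{11}-\big((-1)^{n'+1}H_{2n'}^{-1}+(-1)^{n'}\big)dx^3\Big]^2.$$ (ii) (KK-monopole sequence, level $3+6n'$) For every integer $n'\ge0$: $$ds^2=\mathcal{F}_{2n'-1}\bar{\mathcal{F}}_{2n'-1}H_{2n'+1}\big[(dx^1)^2+(dx^2)^2\big]+H_{2n'+1}(dx^3)^2+(-1)^{n'}\big[(dx^4)^2+\dots+(dx^8)^2\big]+(-1)^{n'+1}\big[(dx^9)^2+(dx^{10})^2\big]+H_{2n'+1}^{-1}\Big[dx^{11}-(-1)^{n'}B_{2n'+1}\,dx^3\Big]^2.$$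
   Context: Coordinates are $x^1,\dots,x^{11}$; all metric components depend only on $(x^1,x^2)$, and $z=x^1+ix^2$. $H,B$ are real functions with $\partial_1H=\partial_2B$, $\partial_2H=-\partial_1B$, so $\mathcal{E}_1=H+iB$ is analytic in $z$. Define recursively $$\mathcal{E}_{2n}=\frac{1}{\mathcal{E}_{2n-1}},\qquad \mathcal{E}_{2n+1}=2-\mathcal{E}_{2n}\qquad(n>0),$$ $$H_p=\mathrm{Re}\,\mathcal{E}_p,\quad B_p=\mathrm{Im}\,\mathcal{E}_p,\qquad \mathcal{F}_{-1}=1,\qquad \mathcal{F}_{2n-1}=\mathcal{E}_1\mathcal{E}_3\cdots\mathcal{E}_{2n-1}\quad(n>0).$$ Everything is considered on an open set of the $(x^1,x^2)$-plane on which all functions entering are defined, the $\mathcal{E}_p$ involved are nonzero, and the function $H_p$ entering the metric is positive. The metrics are pseudo-Riemannian and may have several time directions; the vacuum Einstein equations mean vanishing of the Ricci tensor. *)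

theory Defs
  imports "HOL-Analysis.Analysis"
begin

section \<open>Coordinate Ricci tensor of a pseudo-Riemannian metric\<close>

text \<open>A metric on an open subset of \<open>\<real>\<^sup>n\<close> is given by its component matrix \<open>g x $ i $ j\<close>.\<close>

definition pd :: "'n::finite \<Rightarrow> (real^'n \<Rightarrow> real) \<Rightarrow> real^'n \<Rightarrow> real" where
  "pd k f x = frechet_derivative f (at x) (axis k 1)"

definition C2_on :: "(real^'n::finite) set \<Rightarrow> (real^'n \<Rightarrow> real) \<Rightarrow> bool" where
  "C2_on S f \<longleftrightarrow>
     (\<forall>x\<in>S. f differentiable at x) \<and>
     (\<forall>k. \<forall>x\<in>S. pd k f differentiable at x) \<and>
     (\<forall>k l. continuous_on S (pd l (pd k f)))"

text \<open>No signature is prescribed. \<open>C\<^sup>2\<close> regularity is what makes the derivatives entering the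
  Ricci tensor genuine ones.\<close>

definition pseudo_riemannian_metric_on ::
    "(real^'n::finite) set \<Rightarrow> (real^'n \<Rightarrow> real^'n^'n) \<Rightarrow> bool" where
  "pseudo_riemannian_metric_on S g \<longleftrightarrow>
     open S \<and>
     (\<forall>i j. C2_on S (\<lambda>x. g x $ i $ j)) \<and>
     (\<forall>x\<in>S. transpose (g x) = g x \<and> det (g x) \<noteq> 0)"

definition christoffel ::
    "(real^'n::finite \<Rightarrow> real^'n^'n) \<Rightarrow> 'n \<Rightarrow> 'n \<Rightarrow> 'n \<Rightarrow> real^'n \<Rightarrow> real" where
  "christoffel g k i j x =
     (1/2) * (\<Sum>l\<in>UNIV. matrix_inv (g x) $ k $ l *
        (pd i (\<lambda>y. g y $ j $ l) x + pd j (\<lambda>y. g y $ i $ l) x - pd l (\<lambda>y. g y $ i $ j) x))"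

definition ricci ::
    "(real^'n::finite \<Rightarrow> real^'n^'n) \<Rightarrow> 'n \<Rightarrow> 'n \<Rightarrow> real^'n \<Rightarrow> real" where
  "ricci g i j x =
     (\<Sum>k\<in>UNIV. pd k (christoffel g k i j) x - pd j (christoffel g k i k) x) +
     (\<Sum>k\<in>UNIV. \<Sum>l\<in>UNIV. christoffel g k k l x * christoffel g l i j x
                         - christoffel g k j l x * christoffel g l i k x)"

definition solves_vacuum_einstein_on ::
    "(real^'n::finite) set \<Rightarrow> (real^'n \<Rightarrow> real^'n^'n) \<Rightarrow> bool" where
  "solves_vacuum_einstein_on S g \<longleftrightarrow>
     pseudo_riemannian_metric_on S g \<and> (\<forall>x\<in>S. \<forall>i j. ricci g i j x = 0)"

text \<open>A line element \<open>ds2 x v\<close> is the quadratic form of the metric at \<open>x\<close>, evaluated at the tangent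
  vector \<open>v\<close>, so that \<open>v $ a\<close> plays the role of \<open>dx\<^sup>a\<close>. The metric is its polarization.\<close>

definition metric_of :: "(real^'n::finite \<Rightarrow> real^'n \<Rightarrow> real) \<Rightarrow> real^'n \<Rightarrow> real^'n^'n" where
  "metric_of ds2 x =
     (\<chi> i j. (ds2 x (axis i 1 + axis j 1) - ds2 x (axis i 1) - ds2 x (axis j 1)) / 2)"


section \<open>The functions \<open>\<E>\<^sub>p\<close> and \<open>\<F>\<^sub>2\<^sub>n\<^sub>-\<^sub>1\<close>\<close>

text \<open>The \<open>(x\<^sup>1, x\<^sup>2)\<close>-plane is identified with the complex plane by \<open>z = x\<^sup>1 + \<i> x\<^sup>2\<close>; thus
  \<open>\<partial>\<^sub>1\<close> and \<open>\<partial>\<^sub>2\<close> are the derivatives in the directions \<open>1\<close> and \<open>\<i>\<close>.\<close>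

definition conjugate_harmonic_on ::
    "complex set \<Rightarrow> (complex \<Rightarrow> real) \<Rightarrow> (complex \<Rightarrow> real) \<Rightarrow> bool" where
  "conjugate_harmonic_on U H B \<longleftrightarrow>
     (\<forall>z\<in>U. H differentiable at z \<and> B differentiable at z \<and>
        frechet_derivative H (at z) 1 = frechet_derivative B (at z) \<i> \<and>
        frechet_derivative H (at z) \<i> = - frechet_derivative B (at z) 1)"

text \<open>Indices start at 1; \<open>Efun H B 0\<close> is left unspecified.\<close>

fun Efun :: "(complex \<Rightarrow> real) \<Rightarrow> (complex \<Rightarrow> real) \<Rightarrow> nat \<Rightarrow> complex \<Rightarrow> complex" where
  "Efun H B (Suc 0) z = complex_of_real (H z) + \<i> * complex_of_real (B z)"
| "Efun H B (Suc (Suc m)) z =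
     (if even (Suc (Suc m)) then 1 / Efun H B (Suc m) z else 2 - Efun H B (Suc m) z)"

definition Hfun :: "(complex \<Rightarrow> real) \<Rightarrow> (complex \<Rightarrow> real) \<Rightarrow> nat \<Rightarrow> complex \<Rightarrow> real" where
  "Hfun H B p z = Re (Efun H B p z)"

definition Bfun :: "(complex \<Rightarrow> real) \<Rightarrow> (complex \<Rightarrow> real) \<Rightarrow> nat \<Rightarrow> complex \<Rightarrow> real" where
  "Bfun H B p z = Im (Efun H B p z)"

text \<open>\<open>Fodd H B n\<close> is \<open>\<F>\<^sub>2\<^sub>n\<^sub>-\<^sub>1\<close>; the empty product gives \<open>\<F>\<^sub>-\<^sub>1 = 1\<close>.\<close>

definition Fodd :: "(complex \<Rightarrow> real) \<Rightarrow> (complex \<Rightarrow> real) \<Rightarrow> nat \<Rightarrow> complex \<Rightarrow> complex" where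
  "Fodd H B n z = (\<Prod>k=1..n. Efun H B (2*k - 1) z)"


section \<open>The eleven-dimensional metrics\<close>

text \<open>In the index type \<open>11\<close> (integers modulo 11) the numerals 1, ..., 11 are the eleven distinct
  indices, with \<open>11 = 0\<close>.\<close>

definition plane_point :: "real^11 \<Rightarrow> complex" where
  "plane_point x = Complex (x $ 1) (x $ 2)"

definition kk_wave_ds2 ::
    "(complex \<Rightarrow> real) \<Rightarrow> (complex \<Rightarrow> real) \<Rightarrow> nat \<Rightarrow> real^11 \<Rightarrow> real^11 \<Rightarrow> real" where
  "kk_wave_ds2 H B n x v =
     (let z = plane_point x;
          FF = Re (Fodd H B n z * cnj (Fodd H B n z));
          h = Hfun H B (2*n) z
      in FF * ((v $ 1)^2 + (v $ 2)^2)
         + (-1)^n * inverse h * (v $ 3)^2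
         + (\<Sum>a\<in>{4,5,6,7,8,9,10}. (v $ a)^2)
         + (-1)^(n+1) * h * (v $ 11 - ((-1)^(n+1) * inverse h + (-1)^n) * v $ 3)^2)"

definition kk_monopole_ds2 ::
    "(complex \<Rightarrow> real) \<Rightarrow> (complex \<Rightarrow> real) \<Rightarrow> nat \<Rightarrow> real^11 \<Rightarrow> real^11 \<Rightarrow> real" where
  "kk_monopole_ds2 H B n x v =
     (let z = plane_point x;
          FF = Re (Fodd H B n z * cnj (Fodd H B n z));
          h = Hfun H B (2*n+1) z;
          b = Bfun H B (2*n+1) z
      in FF * h * ((v $ 1)^2 + (v $ 2)^2)
         + h * (v $ 3)^2
         + (-1)^n * (\<Sum>a\<in>{4,5,6,7,8}. (v $ a)^2)
         + (-1)^(n+1) * ((v $ 9)^2 + (v $ 10)^2)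
         + inverse h * (v $ 11 - (-1)^n * b * v $ 3)^2)"

end

theory Submission
  imports Defs "HOL-Complex_Analysis.Cauchy_Integral_Formula"
begin

text \<open>
  Both metrics have the form
  \<open>\<Psi> ((dx\<^sup>1)\<^sup>2 + (dx\<^sup>2)\<^sup>2) + P (dx\<^sup>3)\<^sup>2 + 2 Q dx\<^sup>3 dx\<^sup>1\<^sup>1 + R (dx\<^sup>1\<^sup>1)\<^sup>2\<close> plus a constant
  diagonal part, with coefficients depending on \<open>z\<close> only and with \<open>P R - Q\<^sup>2 = \<delta>\<close> constant. For such a
  metric, with \<open>S = \<Sum>\<^sub>a (\<partial>\<^sub>aP \<partial>\<^sub>aR - (\<partial>\<^sub>aQ)\<^sup>2)\<close>, Ricci flatness reduces to \<open>\<Delta>G = - G S / \<delta>\<close> for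
  \<open>G = P, Q, R\<close>, two Cauchy-Riemann type conditions on \<open>(P, Q, R)\<close>, and
  \<open>\<Delta> ln \<Psi> = S / (2 \<delta>)\<close>.

  In the wave case, \<open>P, Q, R\<close> are affine in the harmonic function \<open>h = H\<^sub>2\<^sub>n\<close>, \<open>S = 0\<close>, and \<open>\<Psi> = |\<F>|\<^sup>2\<close> is
  the squared modulus of a holomorphic function, so \<open>ln \<Psi>\<close> is harmonic. In the monopole case the block
  is the unimodular matrix with \<open>R = 1/h\<close>, \<open>Q = \<mp> b/h\<close>, \<open>P = h + b\<^sup>2/h\<close>, where \<open>h + \<i>b = \<E>\<^sub>2\<^sub>n\<^sub>+\<^sub>1\<close>; then
  \<open>S = - 2 |\<nabla>h|\<^sup>2 / h\<^sup>2 = 2 \<Delta> ln h\<close> and \<open>\<Psi> = |\<F>|\<^sup>2 h\<close>. Only holomorphy of \<open>\<E>\<^sub>p\<close> and \<open>\<F>\<close> enters.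
\<close>

section \<open>Second-order jets of functions of z\<close>

text \<open>This asks for the total derivative, with \<open>s\<close> and \<open>t\<close> its
  values at 1 and i, because the chain rule through \<open>plane\<close> fails for bare partial
  derivatives.\<close>

definition has_partials :: "(complex \<Rightarrow> real) \<Rightarrow> real \<Rightarrow> real \<Rightarrow> complex \<Rightarrow> bool" where
  "has_partials f s t z \<longleftrightarrow> (f has_derivative (\<lambda>w. Re w * s + Im w * t)) (at z)"

lemma has_partials_eq_rhs:
  "has_partials f s t z \<Longrightarrow> f = f' \<Longrightarrow> s = s' \<Longrightarrow> t = t' \<Longrightarrow> has_partials f' s' t' z"
  by simp

lemma has_partials_const: "has_partials (\<lambda>_. k) 0 0 z"
  by (simp add: has_partials_def)

lemma has_partials_add:
  assumes "has_partials f s t z" "has_partials g s' t' z"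
  shows "has_partials (\<lambda>w. f w + g w) (s + s') (t + t') z"
  using has_derivative_add[OF assms[unfolded has_partials_def]]
  by (simp add: has_partials_def algebra_simps)

lemma has_partials_diff:
  assumes "has_partials f s t z" "has_partials g s' t' z"
  shows "has_partials (\<lambda>w. f w - g w) (s - s') (t - t') z"
  using has_derivative_diff[OF assms[unfolded has_partials_def]]
  by (simp add: has_partials_def algebra_simps)

lemma has_partials_mult:
  assumes "has_partials f s t z" "has_partials g s' t' z"
  shows "has_partials (\<lambda>w. f w * g w) (s * g z + f z * s') (t * g z + f z * t') z"
  using has_derivative_mult[OF assms[unfolded has_partials_def]]
  by (simp add: has_partials_def algebra_simps)

lemma has_partials_inverse:
  assumes "has_partials f s t z" "f z \<noteq> 0"
  shows "has_partials (\<lambda>w. inverse (f w)) (- s / (f z)^2) (- t / (f z)^2) z"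
proof -
  have "(\<lambda>w. - (inverse (f z) * (Re w * s + Im w * t) * inverse (f z))) =
      (\<lambda>w. Re w * (- s / (f z)^2) + Im w * (- t / (f z)^2))"
    by (simp add: fun_eq_iff divide_inverse power2_eq_square algebra_simps)
  then show ?thesis
    using Deriv.has_derivative_inverse[OF assms(2) assms(1)[unfolded has_partials_def]]
    by (simp add: has_partials_def)
qed

lemma has_partials_divide:
  assumes "has_partials f s t z" "has_partials g s' t' z" "g z \<noteq> 0"
  shows "has_partials (\<lambda>w. f w / g w)
     (s / g z - f z * s' / (g z)^2) (t / g z - f z * t' / (g z)^2) z"
  using has_partials_mult[OF assms(1) has_partials_inverse[OF assms(2,3)]]
  by (simp add: divide_inverse algebra_simps)

lemma has_partials_imp_isCont: "has_partials f s t z \<Longrightarrow> isCont f z"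
  unfolding has_partials_def by (rule has_derivative_continuous)

text \<open>Second-order Taylor data as plain numbers. Curvature needs two derivatives of the
  coefficients, so with jets the Ricci tensor becomes algebra in these slots. The single slot
  \<open>jdxy\<close> builds in the symmetry of mixed derivatives.\<close>

datatype jet =
  Jet (jval: real) (jdx: real) (jdy: real) (jdxx: real) (jdxy: real) (jdyy: real)

definition jconst :: "real \<Rightarrow> jet" where
  "jconst k = Jet k 0 0 0 0 0"

definition jadd :: "jet \<Rightarrow> jet \<Rightarrow> jet" where
  "jadd F G = Jet (jval F + jval G) (jdx F + jdx G) (jdy F + jdy G)
     (jdxx F + jdxx G) (jdxy F + jdxy G) (jdyy F + jdyy G)"

definition jmul :: "jet \<Rightarrow> jet \<Rightarrow> jet" where
  "jmul F G = Jet (jval F * jval G)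
     (jdx F * jval G + jval F * jdx G) (jdy F * jval G + jval F * jdy G)
     (jdxx F * jval G + 2 * jdx F * jdx G + jval F * jdxx G)
     (jdxy F * jval G + jdx F * jdy G + jdy F * jdx G + jval F * jdxy G)
     (jdyy F * jval G + 2 * jdy F * jdy G + jval F * jdyy G)"

definition jinv :: "jet \<Rightarrow> jet" where
  "jinv F = (let v = jval F in Jet (inverse v) (- jdx F / v^2) (- jdy F / v^2)
     (2 * jdx F * jdx F / v^3 - jdxx F / v^2)
     (2 * jdx F * jdy F / v^3 - jdxy F / v^2)
     (2 * jdy F * jdy F / v^3 - jdyy F / v^2))"

text \<open>Ties the formal slots to genuine derivatives; \<open>jdxy\<close> serves both as
  \<partial>_2 of \<open>jdx\<close> and as \<partial>_1 of \<open>jdy\<close>. Continuity is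
  demanded at second order, as \<open>C2_on\<close> requires; below that it follows from
  differentiability.\<close>

definition jet_on :: "complex set \<Rightarrow> (complex \<Rightarrow> jet) \<Rightarrow> bool" where
  "jet_on U J \<longleftrightarrow>
     (\<forall>z\<in>U. has_partials (\<lambda>w. jval (J w)) (jdx (J z)) (jdy (J z)) z \<and>
            has_partials (\<lambda>w. jdx (J w)) (jdxx (J z)) (jdxy (J z)) z \<and>
            has_partials (\<lambda>w. jdy (J w)) (jdxy (J z)) (jdyy (J z)) z) \<and>
     continuous_on U (\<lambda>z. jdxx (J z)) \<and> continuous_on U (\<lambda>z. jdxy (J z)) \<and>
     continuous_on U (\<lambda>z. jdyy (J z))"

lemma jet_onD:
  assumes "jet_on U J" "z \<in> U"
  shows "has_partials (\<lambda>w. jval (J w)) (jdx (J z)) (jdy (J z)) z"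
    "has_partials (\<lambda>w. jdx (J w)) (jdxx (J z)) (jdxy (J z)) z"
    "has_partials (\<lambda>w. jdy (J w)) (jdxy (J z)) (jdyy (J z)) z"
  using assms by (auto simp: jet_on_def)

lemma jet_on_continuous:
  assumes "jet_on U J"
  shows "continuous_on U (\<lambda>z. jval (J z))" "continuous_on U (\<lambda>z. jdx (J z))"
    "continuous_on U (\<lambda>z. jdy (J z))" "continuous_on U (\<lambda>z. jdxx (J z))"
    "continuous_on U (\<lambda>z. jdxy (J z))" "continuous_on U (\<lambda>z. jdyy (J z))"
  using assms
  by (auto simp: jet_on_def intro!: continuous_at_imp_continuous_on
      intro: has_partials_imp_isCont)

lemma jet_on_const: "jet_on U (\<lambda>_. jconst k)"
  by (simp add: jet_on_def jconst_def has_partials_const)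

lemma jet_on_add:
  assumes "jet_on U F" "jet_on U G"
  shows "jet_on U (\<lambda>z. jadd (F z) (G z))"
  using assms jet_on_continuous[OF assms(1)] jet_on_continuous[OF assms(2)]
  by (auto simp: jet_on_def jadd_def intro!: has_partials_add continuous_intros)

lemma jet_on_mul:
  assumes F: "jet_on U F" and G: "jet_on U G"
  shows "jet_on U (\<lambda>z. jmul (F z) (G z))"
  unfolding jet_on_def
proof (intro conjI ballI)
  fix z assume z: "z \<in> U"
  note f = jet_onD[OF F z] and g = jet_onD[OF G z]
  show "has_partials (\<lambda>w. jval (jmul (F w) (G w))) (jdx (jmul (F z) (G z)))
      (jdy (jmul (F z) (G z))) z"
    using has_partials_mult[OF f(1) g(1)] by (simp add: jmul_def)
  show "has_partials (\<lambda>w. jdx (jmul (F w) (G w))) (jdxx (jmul (F z) (G z)))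
      (jdxy (jmul (F z) (G z))) z"
    using has_partials_add[OF has_partials_mult[OF f(2) g(1)] has_partials_mult[OF f(1) g(2)]]
    by (simp add: jmul_def algebra_simps)
  show "has_partials (\<lambda>w. jdy (jmul (F w) (G w))) (jdxy (jmul (F z) (G z)))
      (jdyy (jmul (F z) (G z))) z"
    using has_partials_add[OF has_partials_mult[OF f(3) g(1)] has_partials_mult[OF f(1) g(3)]]
    by (simp add: jmul_def algebra_simps)
qed (use jet_on_continuous[OF F] jet_on_continuous[OF G] in
    \<open>auto simp: jmul_def intro!: continuous_intros\<close>)

lemma jet_on_inv:
  assumes F: "jet_on U F" and nz: "\<And>z. z \<in> U \<Longrightarrow> jval (F z) \<noteq> 0"
  shows "jet_on U (\<lambda>z. jinv (F z))"
  unfolding jet_on_def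
proof (intro conjI ballI)
  fix z assume z: "z \<in> U"
  note f = jet_onD[OF F z]
  have v: "jval (F z) \<noteq> 0" "(jval (F z))\<^sup>2 \<noteq> 0" using nz z by auto
  note sq = has_partials_mult[OF f(1) f(1), folded power2_eq_square]
  show "has_partials (\<lambda>w. jval (jinv (F w))) (jdx (jinv (F z))) (jdy (jinv (F z))) z"
    using has_partials_inverse[OF f(1) v(1)] by (simp add: jinv_def Let_def)
  show "has_partials (\<lambda>w. jdx (jinv (F w))) (jdxx (jinv (F z))) (jdxy (jinv (F z))) z"
    by (rule has_partials_eq_rhs[OF has_partials_diff[OF has_partials_const[of 0]
            has_partials_divide[OF f(2) sq v(2)]]])
      (use v in \<open>simp_all add: jinv_def Let_def field_simps power2_eq_square power3_eq_cube\<close>)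
  show "has_partials (\<lambda>w. jdy (jinv (F w))) (jdxy (jinv (F z))) (jdyy (jinv (F z))) z"
    by (rule has_partials_eq_rhs[OF has_partials_diff[OF has_partials_const[of 0]
            has_partials_divide[OF f(3) sq v(2)]]])
      (use v in \<open>simp_all add: jinv_def Let_def field_simps power2_eq_square power3_eq_cube\<close>)
qed (use jet_on_continuous[OF F] nz in
    \<open>auto simp: jinv_def Let_def intro!: continuous_intros\<close>)

section \<open>Curvature of metrics depending on two coordinates\<close>

text \<open>\<open>matrix_inv\<close> is a choice of two-sided inverse. For square matrices a left
  inverse is two-sided, so a candidate exists, and associativity forces the choice to equal
  it.\<close>

lemma matrix_inv_unique:
  fixes M :: "real^'m^'m"
  assumes "M' ** M = mat 1"
  shows "matrix_inv M = M'"
proof -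
  have r: "M ** M' = mat 1" using assms by (simp add: matrix_left_right_inverse)
  have "M ** matrix_inv M = mat 1 \<and> matrix_inv M ** M = mat 1"
    unfolding matrix_inv_def by (rule someI[of _ M']) (use assms r in auto)
  then have "M' = M' ** (M ** matrix_inv M)" by simp
  also have "\<dots> = matrix_inv M" by (simp add: matrix_mul_assoc assms)
  finally show ?thesis by simp
qed

text \<open>The plane coordinates are \<open>a\<close> and \<open>b\<close>; the directions
  \<open>c\<close> and \<open>d\<close> carry the block with rows (P, Q) and (Q, R); the remaining
  ones carry constants \<open>e i\<close>. The determinant condition is imposed on jets, so its
  first and second derivatives are available by projection.\<close>

locale block_metric =
  fixes a b c d :: "'n::finite" and e :: "'n \<Rightarrow> real" and \<delta> :: real
    and U :: "complex set" and \<Psi> P Q R :: "complex \<Rightarrow> jet"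
  assumes distinct: "distinct [a, b, c, d]"
    and open_U: "open U"
    and e_nz: "\<And>i. e i \<noteq> 0" and \<delta>_nz: "\<delta> \<noteq> 0"
    and jets: "jet_on U \<Psi>" "jet_on U P" "jet_on U Q" "jet_on U R"
    and \<Psi>_nz: "\<And>z. z \<in> U \<Longrightarrow> jval (\<Psi> z) \<noteq> 0"
    and jet_det: "\<And>z. z \<in> U \<Longrightarrow> jmul (P z) (R z) = jadd (jmul (Q z) (Q z)) (jconst \<delta>)"
begin

lemma neq: "a \<noteq> b" "a \<noteq> c" "a \<noteq> d" "b \<noteq> c" "b \<noteq> d" "c \<noteq> d"
    "b \<noteq> a" "c \<noteq> a" "d \<noteq> a" "c \<noteq> b" "d \<noteq> b" "d \<noteq> c"
  using distinct by auto

definition plane :: "real^'n \<Rightarrow> complex" where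
  "plane x = Complex (x $ a) (x $ b)"

definition entry :: "'n \<Rightarrow> 'n \<Rightarrow> complex \<Rightarrow> jet" where
  "entry i j z =
     (if i = j then
        (if i = a \<or> i = b then \<Psi> z else if i = c then P z else if i = d then R z else jconst (e i))
      else if i = c \<and> j = d \<or> i = d \<and> j = c then Q z else jconst 0)"

definition metric :: "real^'n \<Rightarrow> real^'n^'n" where
  "metric x = (\<chi> i j. jval (entry i j (plane x)))"

text \<open>Contraction of a covector with the inverse metric in closed form: the (c, d) block is
  inverted by its adjugate over the determinant \<delta>.\<close>

definition raise :: "complex \<Rightarrow> ('n \<Rightarrow> real) \<Rightarrow> 'n \<Rightarrow> real" where
  "raise z X k =
     (if k = a \<or> k = b then X k / jval (\<Psi> z)
      else if k = c then (jval (R z) * X c - jval (Q z) * X d) / \<delta>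
      else if k = d then (jval (P z) * X d - jval (Q z) * X c) / \<delta>
      else X k / e k)"

definition jet_pd :: "'n \<Rightarrow> jet \<Rightarrow> real" where
  "jet_pd m J = (if m = a then jdx J else if m = b then jdy J else 0)"

definition jet_pd2 :: "'n \<Rightarrow> 'n \<Rightarrow> jet \<Rightarrow> real" where
  "jet_pd2 m i J =
     (if m = a then (if i = a then jdxx J else if i = b then jdxy J else 0)
      else if m = b then (if i = a then jdxy J else if i = b then jdyy J else 0)
      else 0)"

definition lower :: "'n \<Rightarrow> 'n \<Rightarrow> 'n \<Rightarrow> complex \<Rightarrow> real" where
  "lower l i j z = jet_pd i (entry j l z) + jet_pd j (entry i l z) - jet_pd l (entry i j z)"

definition dlower :: "'n \<Rightarrow> 'n \<Rightarrow> 'n \<Rightarrow> 'n \<Rightarrow> complex \<Rightarrow> real" where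
  "dlower m l i j z = jet_pd2 m i (entry j l z) + jet_pd2 m j (entry i l z) - jet_pd2 m l (entry i j z)"

text \<open>\<open>lower\<close> and \<open>Gam\<close> are the Christoffel symbols of the first (doubled) and second kind as functions
  on the plane; \<open>dlower\<close> and \<open>dGam\<close>, with an additional first index, are their partial derivatives.\<close>

definition Gam :: "'n \<Rightarrow> 'n \<Rightarrow> 'n \<Rightarrow> complex \<Rightarrow> real" where
  "Gam k i j z = 1/2 * raise z (\<lambda>l. lower l i j z) k"

definition dGam :: "'n \<Rightarrow> 'n \<Rightarrow> 'n \<Rightarrow> 'n \<Rightarrow> complex \<Rightarrow> real" where
  "dGam m k i j z = 1/2 *
     (if k = a \<or> k = b then
        dlower m k i j z / jval (\<Psi> z) - lower k i j z * jet_pd m (\<Psi> z) / (jval (\<Psi> z))^2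
      else if k = c then
        (jet_pd m (R z) * lower c i j z + jval (R z) * dlower m c i j z
         - (jet_pd m (Q z) * lower d i j z + jval (Q z) * dlower m d i j z)) / \<delta>
      else if k = d then
        (jet_pd m (P z) * lower d i j z + jval (P z) * dlower m d i j z
         - (jet_pd m (Q z) * lower c i j z + jval (Q z) * dlower m c i j z)) / \<delta>
      else dlower m k i j z / e k)"

lemma det_val: "z \<in> U \<Longrightarrow> jval (P z) * jval (R z) = jval (Q z) * jval (Q z) + \<delta>"
  using arg_cong[OF jet_det, of z jval] by (simp add: jmul_def jadd_def jconst_def)

text \<open>The case distinctions in \<open>entry\<close> do not involve z, so they move outside the
  abstraction and leave one of the given jets or a constant.\<close>

lemma jet_on_entry: "jet_on U (entry i j)"
proof -
  have "entry i j =
     (if i = j then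
        (if i = a \<or> i = b then \<Psi> else if i = c then P else if i = d then R else (\<lambda>_. jconst (e i)))
      else if i = c \<and> j = d \<or> i = d \<and> j = c then Q else (\<lambda>_. jconst 0))"
    by (rule ext) (simp only: entry_def if_distribR)
  then show ?thesis
    by (simp only: jets jet_on_const split: if_split) blast
qed

lemma entry_sym: "entry i j z = entry j i z"
  by (auto simp: entry_def)

definition inverse_metric :: "complex \<Rightarrow> real^'n^'n" where
  "inverse_metric z = (\<chi> k l. raise z (\<lambda>m. if m = l then 1 else 0) k)"

text \<open>\<open>raise\<close> is linear and each of its components reads at most two values of
  \<open>X\<close>, so sums over Kronecker deltas recover it.\<close>

lemma sum_inverse_metric: "(\<Sum>l\<in>UNIV. inverse_metric z $ k $ l * X l) = raise z X k"
proof -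
  have delta: "(\<Sum>l\<in>UNIV. s * (if m = l then 1 else 0) * X l) = s * X m" for s :: real and m
  proof -
    have "(\<Sum>l\<in>UNIV. s * (if m = l then 1 else 0) * X l) = (\<Sum>l\<in>UNIV. if m = l then s * X l else 0)"
      by (rule sum.cong) auto
    then show ?thesis by simp
  qed
  have two: "(\<Sum>l\<in>UNIV. (s * (if m = l then 1 else 0) - t * (if k = l then 1 else 0)) * X l / u)
      = (s * X m - t * X k) / u" for s t u :: real and m k
    using delta[of "s / u" m] delta[of "t / u" k]
    by (simp add: diff_divide_distrib left_diff_distrib sum_subtractf)
  have one: "(\<Sum>l\<in>UNIV. (if m = l then 1 else 0) * X l / u) = X m / u" for u :: real and m
    using delta[of "1 / u" m] by simp
  show ?thesis
    unfolding inverse_metric_def raise_def vec_lambda_beta using neq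
    by (auto simp: one two)
qed

lemma inverse_metric_mult:
  assumes "plane x \<in> U"
  shows "inverse_metric (plane x) ** metric x = mat 1"
proof -
  \<comment> \<open>Raising column j of the metric gives back the j-th unit vector; in the (c, d)
    block this is P R - Q^2 = \<delta>.\<close>
  have "raise (plane x) (\<lambda>l. jval (entry l j (plane x))) k = (if k = j then 1 else 0)" for k j
    using neq \<Psi>_nz[OF assms] e_nz \<delta>_nz det_val[OF assms]
    by (auto simp: raise_def entry_def jconst_def algebra_simps)
  then show ?thesis
    by (simp add: vec_eq_iff matrix_matrix_mult_def mat_def metric_def sum_inverse_metric)
qed

lemma matrix_inv_metric:
  "plane x \<in> U \<Longrightarrow> matrix_inv (metric x) = inverse_metric (plane x)"
  by (rule matrix_inv_unique[OF inverse_metric_mult])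

lemma det_metric_nz: "plane x \<in> U \<Longrightarrow> det (metric x) \<noteq> 0"
  using inverse_metric_mult invertible_det_nz invertible_left_inverse by blast

lemma has_derivative_plane:
  assumes "has_partials f s t (plane x)"
  shows "((\<lambda>y. f (plane y)) has_derivative (\<lambda>v. v $ a * s + v $ b * t)) (at x)"
proof -
  have "(plane has_derivative plane) (at x)"
    unfolding plane_def Complex_eq
    by (auto intro!: derivative_eq_intros
        bounded_linear_imp_has_derivative[OF bounded_linear_vec_nth])
  from has_derivative_compose[OF this assms[unfolded has_partials_def]]
  show ?thesis by (simp add: plane_def)
qed

lemma pd_plane:
  assumes "has_partials f s t (plane x)"
  shows "pd k (\<lambda>y. f (plane y)) x = (if k = a then s else if k = b then t else 0)"
  unfolding pd_def frechet_derivative_at[OF has_derivative_plane[OF assms], symmetric]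
  using neq by (auto simp: axis_def)

lemma open_plane: "open {x. plane x \<in> U}"
proof -
  have "continuous_on UNIV plane"
    unfolding plane_def Complex_eq by (intro continuous_intros)
  from open_vimage[OF open_U this] show ?thesis by (simp add: vimage_def)
qed

text \<open>First derivatives and Christoffel symbols are known as functions of z only over
  \<open>U\<close>. Derivatives are local, so agreement on the open preimage of \<open>U\<close>
  suffices to differentiate them once more.\<close>

lemma pd_cong:
  assumes "has_partials f s t (plane x)" "plane x \<in> U"
    and "\<And>y. plane y \<in> U \<Longrightarrow> h y = f (plane y)"
  shows "(h has_derivative (\<lambda>v. v $ a * s + v $ b * t)) (at x)"
    and "pd k h x = (if k = a then s else if k = b then t else 0)"
proof -
  show *: "(h has_derivative (\<lambda>v. v $ a * s + v $ b * t)) (at x)"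
    by (rule has_derivative_transform_within_open[OF has_derivative_plane[OF assms(1)] open_plane])
      (use assms in auto)
  show "pd k h x = (if k = a then s else if k = b then t else 0)"
    unfolding pd_def frechet_derivative_at[OF *, symmetric]
    using neq by (auto simp: axis_def)
qed

lemma pd_jet:
  assumes "jet_on U J" "plane x \<in> U"
  shows "pd k (\<lambda>y. jval (J (plane y))) x = jet_pd k (J (plane x))"
  using pd_plane[OF jet_onD(1)[OF assms]] by (simp add: jet_pd_def)

lemma has_partials_jet_pd:
  assumes "jet_on U J" "z \<in> U"
  shows "has_partials (\<lambda>w. jet_pd i (J w)) (jet_pd2 a i (J z)) (jet_pd2 b i (J z)) z"
  using jet_onD[OF assms] neq by (auto simp: jet_pd_def jet_pd2_def has_partials_const)

lemma C2_on_jet: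
  assumes "jet_on U J"
  shows "C2_on {x. plane x \<in> U} (\<lambda>y. jval (J (plane y)))"
  unfolding C2_on_def
proof (intro conjI ballI allI)
  let ?f = "\<lambda>y. jval (J (plane y))"
  fix x assume "x \<in> {x. plane x \<in> U}"
  then have x: "plane x \<in> U" by simp
  show "?f differentiable at x"
    using has_derivative_plane[OF jet_onD(1)[OF assms x]] by (auto simp: differentiable_def)
  show "pd k ?f differentiable at x" for k
    using pd_cong(1)[OF has_partials_jet_pd[OF assms x] x, of "pd k ?f" k] pd_jet[OF assms]
    by (auto simp: differentiable_def)
next
  let ?f = "\<lambda>y. jval (J (plane y))"
  fix k l
  have "continuous_on U (\<lambda>z. jet_pd2 l k (J z))"
    unfolding jet_pd2_def
    by (cases "l = a"; cases "l = b"; cases "k = a"; cases "k = b")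
      (use jet_on_continuous[OF assms] neq in simp_all)
  moreover have "continuous_on {x. plane x \<in> U} plane"
    unfolding plane_def Complex_eq by (intro continuous_intros)
  ultimately have "continuous_on {x. plane x \<in> U} (\<lambda>y. jet_pd2 l k (J (plane y)))"
    by (rule continuous_on_compose2) auto
  moreover have "pd l (pd k ?f) x = jet_pd2 l k (J (plane x))" if x: "plane x \<in> U" for x
    using pd_cong(2)[OF has_partials_jet_pd[OF assms x] x, of "pd k ?f" k l] pd_jet[OF assms] neq
    by (auto simp: jet_pd2_def)
  ultimately show "continuous_on {x. plane x \<in> U} (pd l (pd k ?f))"
    by (simp cong: continuous_on_cong_simp)
qed

lemma pseudo_riemannian: "pseudo_riemannian_metric_on {x. plane x \<in> U} metric"
  unfolding pseudo_riemannian_metric_on_def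
  using open_plane C2_on_jet[OF jet_on_entry] det_metric_nz
  by (auto simp: metric_def transpose_def vec_eq_iff entry_sym)

lemma christoffel_metric:
  assumes "plane x \<in> U"
  shows "christoffel metric k i j x = Gam k i j (plane x)"
  unfolding christoffel_def matrix_inv_metric[OF assms] Gam_def
  by (simp add: metric_def pd_jet[OF jet_on_entry assms] lower_def flip: sum_inverse_metric)

lemma has_partials_lower:
  assumes "z \<in> U"
  shows "has_partials (lower l i j) (dlower a l i j z) (dlower b l i j z) z"
  using has_partials_diff[OF has_partials_add[OF has_partials_jet_pd[OF jet_on_entry assms]
        has_partials_jet_pd[OF jet_on_entry assms]] has_partials_jet_pd[OF jet_on_entry assms]]
  unfolding lower_def dlower_def .

lemma has_partials_Gam:
  assumes z: "z \<in> U"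
  shows "has_partials (Gam k i j) (dGam a k i j z) (dGam b k i j z) z"
proof -
  note h = has_partials_mult[OF has_partials_const[of "1/2"]]
  note dv = has_partials_divide[OF _ has_partials_const]
  note n = has_partials_lower[OF z]
  note v = jet_onD(1)[OF jets(1) z] jet_onD(1)[OF jets(2) z] jet_onD(1)[OF jets(3) z]
    jet_onD(1)[OF jets(4) z]
  \<comment> \<open>The four cases follow the branches of \<open>raise\<close>; in the last three
    the divisor is constant.\<close>
  consider "k = a \<or> k = b" | "k = c" | "k = d" | "k \<notin> {a, b, c, d}" by blast
  then show ?thesis
  proof cases
    case 1
    show ?thesis
      by (rule has_partials_eq_rhs[OF h[OF has_partials_divide[OF n[of k i j] v(1) \<Psi>_nz[OF z]]]])
        (use 1 neq in \<open>auto simp: fun_eq_iff Gam_def raise_def dGam_def jet_pd_def\<close>)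
  next
    case 2
    show ?thesis
      by (rule has_partials_eq_rhs[OF h[OF dv[OF has_partials_diff[OF
                has_partials_mult[OF v(4) n[of c i j]] has_partials_mult[OF v(3) n[of d i j]]]
                \<delta>_nz]]])
        (use 2 neq in \<open>auto simp: fun_eq_iff Gam_def raise_def dGam_def jet_pd_def\<close>)
  next
    case 3
    show ?thesis
      by (rule has_partials_eq_rhs[OF h[OF dv[OF has_partials_diff[OF
                has_partials_mult[OF v(2) n[of d i j]] has_partials_mult[OF v(3) n[of c i j]]]
                \<delta>_nz]]])
        (use 3 neq in \<open>auto simp: fun_eq_iff Gam_def raise_def dGam_def jet_pd_def\<close>)
  next
    case 4
    show ?thesis
      by (rule has_partials_eq_rhs[OF h[OF dv[OF n[of k i j] e_nz[of k]]]])
        (use 4 neq in \<open>auto simp: fun_eq_iff Gam_def raise_def dGam_def jet_pd_def\<close>)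
  qed
qed

lemma dGam_eq_0: "m \<noteq> a \<Longrightarrow> m \<noteq> b \<Longrightarrow> dGam m k i j z = 0"
  by (simp add: dGam_def dlower_def jet_pd2_def jet_pd_def)

lemma pd_christoffel:
  assumes "plane x \<in> U"
  shows "pd m (christoffel metric k i j) x = dGam m k i j (plane x)"
  using pd_cong(2)[OF has_partials_Gam[OF assms] assms christoffel_metric]
  by (auto simp: dGam_eq_0)

text \<open>With an index outside the four, each term of \<open>lower\<close> either differentiates
  along a coordinate on which nothing depends or differentiates a constant metric entry. This
  confines all curvature sums to four indices, whatever the dimension.\<close>

lemma Gam_eq_0:
  assumes "k \<notin> {a, b, c, d} \<or> i \<notin> {a, b, c, d} \<or> j \<notin> {a, b, c, d}"
  shows "Gam k i j z = 0" "dGam m k i j z = 0"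
proof -
  have pd_out: "jet_pd m J = 0" "jet_pd2 m i J = 0" "jet_pd2 i m J = 0" if "m \<notin> {a, b, c, d}" for m i J
    using that by (simp_all add: jet_pd_def jet_pd2_def)
  have entry_out: "jet_pd m (entry i j z) = 0" "jet_pd2 m l (entry i j z) = 0"
    if "i \<notin> {a, b, c, d} \<or> j \<notin> {a, b, c, d}" for m l i j
  proof -
    have "entry i j z \<in> {jconst (e i), jconst 0}" using that by (auto simp: entry_def)
    then show "jet_pd m (entry i j z) = 0" "jet_pd2 m l (entry i j z) = 0"
      by (auto simp: jconst_def jet_pd_def jet_pd2_def)
  qed
  have lower_out: "lower l i j z = 0" "dlower m l i j z = 0"
    if "l \<notin> {a, b, c, d} \<or> i \<notin> {a, b, c, d} \<or> j \<notin> {a, b, c, d}" for l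
    using that by (elim disjE; simp add: lower_def dlower_def pd_out entry_out)+
  \<comment> \<open>For \<open>k\<close> outside, \<open>raise\<close> only divides by
    \<open>e k\<close> and so involves \<open>lower k i j\<close> alone; for \<open>i\<close> or
    \<open>j\<close> outside, \<open>lower l i j\<close> vanishes for every
    \<open>l\<close>.\<close>
  have "Gam k i j z = 0 \<and> dGam m k i j z = 0"
  proof (cases "i \<in> {a, b, c, d} \<and> j \<in> {a, b, c, d}")
    case True
    then have "k \<notin> {a, b, c, d}" using assms by blast
    then show ?thesis using lower_out[of k] by (simp add: Gam_def dGam_def raise_def)
  next
    case False
    then show ?thesis using lower_out by (auto simp: Gam_def dGam_def raise_def)
  qed
  then show "Gam k i j z = 0" "dGam m k i j z = 0" by auto
qed

lemma ricci_metric: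
  assumes x: "plane x \<in> U"
  defines "z \<equiv> plane x"
  shows "ricci metric i j x =
     (\<Sum>k\<in>{a, b, c, d}. dGam k k i j z - dGam j k i k z) +
     (\<Sum>k\<in>{a, b, c, d}. \<Sum>l\<in>{a, b, c, d}. Gam k k l z * Gam l i j z - Gam k j l z * Gam l i k z)"
proof -
  have restrict: "(\<Sum>k\<in>UNIV. X k) = (\<Sum>k\<in>{a, b, c, d}. X k)"
    if "\<And>k. k \<notin> {a, b, c, d} \<Longrightarrow> X k = 0" for X :: "'n \<Rightarrow> real"
    by (rule sum.mono_neutral_right) (use that in auto)
  have "ricci metric i j x =
     (\<Sum>k\<in>UNIV. dGam k k i j z - dGam j k i k z) +
     (\<Sum>k\<in>UNIV. \<Sum>l\<in>UNIV. Gam k k l z * Gam l i j z - Gam k j l z * Gam l i k z)"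
    unfolding ricci_def z_def by (simp add: pd_christoffel[OF x] christoffel_metric[OF x])
  also have "(\<Sum>k\<in>UNIV. \<Sum>l\<in>UNIV. Gam k k l z * Gam l i j z - Gam k j l z * Gam l i k z) =
      (\<Sum>k\<in>UNIV. \<Sum>l\<in>{a, b, c, d}. Gam k k l z * Gam l i j z - Gam k j l z * Gam l i k z)"
    by (intro sum.cong refl restrict) (simp add: Gam_eq_0)
  also have "\<dots> = (\<Sum>k\<in>{a, b, c, d}. \<Sum>l\<in>{a, b, c, d}.
      Gam k k l z * Gam l i j z - Gam k j l z * Gam l i k z)"
    by (intro restrict) (simp add: Gam_eq_0)
  also have "(\<Sum>k\<in>UNIV. dGam k k i j z - dGam j k i k z) =
      (\<Sum>k\<in>{a, b, c, d}. dGam k k i j z - dGam j k i k z)"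
    by (intro restrict) (simp add: Gam_eq_0)
  finally show ?thesis .
qed

section \<open>Christoffel and Ricci components on the four block indices\<close>

lemmas table_defs = entry_def lower_def dlower_def jet_pd_def jet_pd2_def raise_def jconst_def neq

text \<open>Symbols with an odd number of indices in {c, d} vanish, because the metric is invariant
  under reversing x^c and x^d together. Those with indices in {a, b} only belong to the conformally
  flat plane metric.\<close>

lemma Gam_table:
  shows
    "Gam a a a z = jdx (\<Psi> z) / (2 * jval (\<Psi> z))"
    "Gam a a b z = jdy (\<Psi> z) / (2 * jval (\<Psi> z))"
    "Gam a a c z = 0"
    "Gam a a d z = 0"
    "Gam a b a z = jdy (\<Psi> z) / (2 * jval (\<Psi> z))"
    "Gam a b b z = - jdx (\<Psi> z) / (2 * jval (\<Psi> z))"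
    "Gam a b c z = 0"
    "Gam a b d z = 0"
    "Gam a c a z = 0"
    "Gam a c b z = 0"
    "Gam a c c z = - jdx (P z) / (2 * jval (\<Psi> z))"
    "Gam a c d z = - jdx (Q z) / (2 * jval (\<Psi> z))"
    "Gam a d a z = 0"
    "Gam a d b z = 0"
    "Gam a d c z = - jdx (Q z) / (2 * jval (\<Psi> z))"
    "Gam a d d z = - jdx (R z) / (2 * jval (\<Psi> z))"
    "Gam b a a z = - jdy (\<Psi> z) / (2 * jval (\<Psi> z))"
    "Gam b a b z = jdx (\<Psi> z) / (2 * jval (\<Psi> z))"
    "Gam b a c z = 0"
    "Gam b a d z = 0"
    "Gam b b a z = jdx (\<Psi> z) / (2 * jval (\<Psi> z))"
    "Gam b b b z = jdy (\<Psi> z) / (2 * jval (\<Psi> z))"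
    "Gam b b c z = 0"
    "Gam b b d z = 0"
    "Gam b c a z = 0"
    "Gam b c b z = 0"
    "Gam b c c z = - jdy (P z) / (2 * jval (\<Psi> z))"
    "Gam b c d z = - jdy (Q z) / (2 * jval (\<Psi> z))"
    "Gam b d a z = 0"
    "Gam b d b z = 0"
    "Gam b d c z = - jdy (Q z) / (2 * jval (\<Psi> z))"
    "Gam b d d z = - jdy (R z) / (2 * jval (\<Psi> z))"
    "Gam c a a z = 0"
    "Gam c a b z = 0"
    "Gam c a c z = (jval (R z) * jdx (P z) - jval (Q z) * jdx (Q z)) / (2 * \<delta>)"
    "Gam c a d z = (jval (R z) * jdx (Q z) - jval (Q z) * jdx (R z)) / (2 * \<delta>)"
    "Gam c b a z = 0"
    "Gam c b b z = 0"
    "Gam c b c z = (jval (R z) * jdy (P z) - jval (Q z) * jdy (Q z)) / (2 * \<delta>)"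
    "Gam c b d z = (jval (R z) * jdy (Q z) - jval (Q z) * jdy (R z)) / (2 * \<delta>)"
    "Gam c c a z = (jval (R z) * jdx (P z) - jval (Q z) * jdx (Q z)) / (2 * \<delta>)"
    "Gam c c b z = (jval (R z) * jdy (P z) - jval (Q z) * jdy (Q z)) / (2 * \<delta>)"
    "Gam c c c z = 0"
    "Gam c c d z = 0"
    "Gam c d a z = (jval (R z) * jdx (Q z) - jval (Q z) * jdx (R z)) / (2 * \<delta>)"
    "Gam c d b z = (jval (R z) * jdy (Q z) - jval (Q z) * jdy (R z)) / (2 * \<delta>)"
    "Gam c d c z = 0"
    "Gam c d d z = 0"
    "Gam d a a z = 0"
    "Gam d a b z = 0"
    "Gam d a c z = (jval (P z) * jdx (Q z) - jval (Q z) * jdx (P z)) / (2 * \<delta>)"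
    "Gam d a d z = (jval (P z) * jdx (R z) - jval (Q z) * jdx (Q z)) / (2 * \<delta>)"
    "Gam d b a z = 0"
    "Gam d b b z = 0"
    "Gam d b c z = (jval (P z) * jdy (Q z) - jval (Q z) * jdy (P z)) / (2 * \<delta>)"
    "Gam d b d z = (jval (P z) * jdy (R z) - jval (Q z) * jdy (Q z)) / (2 * \<delta>)"
    "Gam d c a z = (jval (P z) * jdx (Q z) - jval (Q z) * jdx (P z)) / (2 * \<delta>)"
    "Gam d c b z = (jval (P z) * jdy (Q z) - jval (Q z) * jdy (P z)) / (2 * \<delta>)"
    "Gam d c c z = 0"
    "Gam d c d z = 0"
    "Gam d d a z = (jval (P z) * jdx (R z) - jval (Q z) * jdx (Q z)) / (2 * \<delta>)"
    "Gam d d b z = (jval (P z) * jdy (R z) - jval (Q z) * jdy (Q z)) / (2 * \<delta>)"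
    "Gam d d c z = 0"
    "Gam d d d z = 0"
  by (simp_all add: Gam_def table_defs)

lemma jet_det_eqs:
  assumes "z \<in> U"
  shows "jdx (P z) * jval (R z) + jval (P z) * jdx (R z) = 2 * jval (Q z) * jdx (Q z)"
    and "jdy (P z) * jval (R z) + jval (P z) * jdy (R z) = 2 * jval (Q z) * jdy (Q z)"
    and "jdxx (P z) * jval (R z) + 2 * jdx (P z) * jdx (R z) + jval (P z) * jdxx (R z)
       = 2 * jdx (Q z) * jdx (Q z) + 2 * jval (Q z) * jdxx (Q z)"
    and "jdxy (P z) * jval (R z) + jdx (P z) * jdy (R z) + jdy (P z) * jdx (R z)
         + jval (P z) * jdxy (R z)
       = 2 * jdx (Q z) * jdy (Q z) + 2 * jval (Q z) * jdxy (Q z)"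
    and "jdyy (P z) * jval (R z) + 2 * jdy (P z) * jdy (R z) + jval (P z) * jdyy (R z)
       = 2 * jdy (Q z) * jdy (Q z) + 2 * jval (Q z) * jdyy (Q z)"
  using jet_det[OF assms] by (auto simp: jmul_def jadd_def jconst_def)

text \<open>The sum over the plane directions of the determinant of the differentiated block: up to
  a factor, the energy density of the block as a map into symmetric 2x2 matrices of determinant
  \<delta>.\<close>

definition S :: "complex \<Rightarrow> real" where
  "S z = jdx (P z) * jdx (R z) - jdx (Q z) * jdx (Q z)
       + (jdy (P z) * jdy (R z) - jdy (Q z) * jdy (Q z))"

text \<open>\<open>harmonic\<close> is the harmonic map equation for the block and annihilates the
  components in c and d. \<open>xy\<close> and \<open>xx\<close> express its conformality:
  \<open>xy\<close> annihilates the ab component, and \<open>xx\<close> splits \<open>S z\<close>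
  evenly between the two plane directions, so that \<open>log\<close> annihilates both aa and
  bb.\<close>

lemma ricci_eq_0:
  assumes x: "plane x \<in> U"
  defines "z \<equiv> plane x"
  assumes harmonic: "\<And>J. J \<in> {P, Q, R} \<Longrightarrow> jdxx (J z) + jdyy (J z) = - jval (J z) * S z / \<delta>"
    and xy: "jdx (P z) * jdy (R z) + jdy (P z) * jdx (R z) = 2 * jdx (Q z) * jdy (Q z)"
    and xx: "jdx (P z) * jdx (R z) - jdx (Q z) * jdx (Q z)
           = jdy (P z) * jdy (R z) - jdy (Q z) * jdy (Q z)"
    and log: "jval (\<Psi> z) * (jdxx (\<Psi> z) + jdyy (\<Psi> z))
      - (jdx (\<Psi> z) * jdx (\<Psi> z) + jdy (\<Psi> z) * jdy (\<Psi> z))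
      = jval (\<Psi> z) * jval (\<Psi> z) * S z / (2 * \<delta>)"
  shows "ricci metric i j x = 0"
proof -
  define p px py pxx pxy pyy where "p = jval (P z)" "px = jdx (P z)" "py = jdy (P z)"
    "pxx = jdxx (P z)" "pxy = jdxy (P z)" "pyy = jdyy (P z)"
  define q qx qy qxx qxy qyy where "q = jval (Q z)" "qx = jdx (Q z)" "qy = jdy (Q z)"
    "qxx = jdxx (Q z)" "qxy = jdxy (Q z)" "qyy = jdyy (Q z)"
  define r rx ry rxx rxy ryy where "r = jval (R z)" "rx = jdx (R z)" "ry = jdy (R z)"
    "rxx = jdxx (R z)" "rxy = jdxy (R z)" "ryy = jdyy (R z)"
  define u ux uy uxx uxy uyy where "u = jval (\<Psi> z)" "ux = jdx (\<Psi> z)" "uy = jdy (\<Psi> z)"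
    "uxx = jdxx (\<Psi> z)" "uxy = jdxy (\<Psi> z)" "uyy = jdyy (\<Psi> z)"
  note defs = p_px_py_pxx_pxy_pyy_def q_qx_qy_qxx_qxy_qyy_def r_rx_ry_rxx_rxy_ryy_def
    u_ux_uy_uxx_uxy_uyy_def
  \<comment> \<open>With the inverses as atoms, the component formulas below are polynomial
    identities in the jet slots, \<open>v\<close> and \<open>k\<close>.\<close>
  define v where "v = inverse u"
  define k where "k = inverse \<delta>"
  have zU: "z \<in> U" using x by (simp add: z_def)
  have det: "p * r = q * q + \<delta>" using det_val[OF zU] by (simp add: defs)
  have u: "u \<noteq> 0" "u * v = 1" using \<Psi>_nz[OF zU] by (simp_all add: defs v_def)
  note det_eqs = jet_det_eqs[OF zU, folded defs]
  note fold = defs[symmetric] v_def[symmetric] k_def[symmetric]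
  \<comment> \<open>In each component the brackets \<open>px * r + p * rx - 2 * q * qx\<close> etc. are the derivatives of
    \<open>P R - Q\<^sup>2 = \<delta>\<close>; what remains after dropping them are the field equations.\<close>
  have cc: "ricci metric c c x =
     - v / 2 * (pxx + pyy + p * (px * rx - qx * qx + (py * ry - qy * qy)) * k)
     + v * k / 4 * (px * (px * r + p * rx - 2 * q * qx) + py * (py * r + p * ry - 2 * q * qy))"
    by (simp add: ricci_metric[OF x] neq Gam_table dGam_def, simp add: table_defs flip: z_def,
        simp only: divide_inverse inverse_mult_distrib power2_eq_square fold, simp add: field_simps)
  have cd: "ricci metric c d x =
     - v / 2 * (qxx + qyy + q * (px * rx - qx * qx + (py * ry - qy * qy)) * k)
     + v * k / 4 * (qx * (px * r + p * rx - 2 * q * qx) + qy * (py * r + p * ry - 2 * q * qy))"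
    by (simp add: ricci_metric[OF x] neq Gam_table dGam_def, simp add: table_defs flip: z_def,
        simp only: divide_inverse inverse_mult_distrib power2_eq_square fold, simp add: field_simps)
  have dc: "ricci metric d c x =
     - v / 2 * (qxx + qyy + q * (px * rx - qx * qx + (py * ry - qy * qy)) * k)
     + v * k / 4 * (qx * (px * r + p * rx - 2 * q * qx) + qy * (py * r + p * ry - 2 * q * qy))"
    by (simp add: ricci_metric[OF x] neq Gam_table dGam_def, simp add: table_defs flip: z_def,
        simp only: divide_inverse inverse_mult_distrib power2_eq_square fold, simp add: field_simps)
  have dd: "ricci metric d d x =
     - v / 2 * (rxx + ryy + r * (px * rx - qx * qx + (py * ry - qy * qy)) * k)
     + v * k / 4 * (rx * (px * r + p * rx - 2 * q * qx) + ry * (py * r + p * ry - 2 * q * qy))"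
    by (simp add: ricci_metric[OF x] neq Gam_table dGam_def, simp add: table_defs flip: z_def,
        simp only: divide_inverse inverse_mult_distrib power2_eq_square fold, simp add: field_simps)
  have ab: "ricci metric a b x =
     - k / 2 * (pxy * r + px * ry + py * rx + p * rxy - 2 * qx * qy - 2 * q * qxy)
     + k * v / 4 * ((px * r + p * rx - 2 * q * qx) * uy + (py * r + p * ry - 2 * q * qy) * ux)
     - k * k / 4 * (px * r + p * rx - 2 * q * qx) * (py * r + p * ry - 2 * q * qy)
     + k * k / 4 * (p * r - q * q) * (px * ry + py * rx - 2 * qx * qy)"
    by (simp add: ricci_metric[OF x] neq Gam_table dGam_def, simp add: table_defs flip: z_def,
        simp only: divide_inverse inverse_mult_distrib power2_eq_square fold, simp add: field_simps)
  have ba: "ricci metric b a x =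
     - k / 2 * (pxy * r + px * ry + py * rx + p * rxy - 2 * qx * qy - 2 * q * qxy)
     + k * v / 4 * ((px * r + p * rx - 2 * q * qx) * uy + (py * r + p * ry - 2 * q * qy) * ux)
     - k * k / 4 * (px * r + p * rx - 2 * q * qx) * (py * r + p * ry - 2 * q * qy)
     + k * k / 4 * (p * r - q * q) * (px * ry + py * rx - 2 * qx * qy)"
    by (simp add: ricci_metric[OF x] neq Gam_table dGam_def, simp add: table_defs flip: z_def,
        simp only: divide_inverse inverse_mult_distrib power2_eq_square fold, simp add: field_simps)
  have aa: "ricci metric a a x =
     - v / 2 * (uxx + uyy) + v * v / 2 * (ux * ux + uy * uy)
     - k / 2 * (pxx * r + 2 * px * rx + p * rxx - 2 * qx * qx - 2 * q * qxx)
     + k * v / 4 * ((px * r + p * rx - 2 * q * qx) * ux - (py * r + p * ry - 2 * q * qy) * uy)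
     - k * k / 4 * ((px * r + p * rx - 2 * q * qx) * (px * r + p * rx - 2 * q * qx))
     + k * k / 2 * (p * r - q * q) * (px * rx - qx * qx)"
    by (simp add: ricci_metric[OF x] neq Gam_table dGam_def, simp add: table_defs flip: z_def,
        simp only: divide_inverse inverse_mult_distrib power2_eq_square fold, simp add: field_simps)
  have bb: "ricci metric b b x =
     - v / 2 * (uxx + uyy) + v * v / 2 * (ux * ux + uy * uy)
     - k / 2 * (pyy * r + 2 * py * ry + p * ryy - 2 * qy * qy - 2 * q * qyy)
     + k * v / 4 * ((py * r + p * ry - 2 * q * qy) * uy - (px * r + p * rx - 2 * q * qx) * ux)
     - k * k / 4 * ((py * r + p * ry - 2 * q * qy) * (py * r + p * ry - 2 * q * qy))
     + k * k / 2 * (p * r - q * q) * (py * ry - qy * qy)"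
    by (simp add: ricci_metric[OF x] neq Gam_table dGam_def, simp add: table_defs flip: z_def,
        simp only: divide_inverse inverse_mult_distrib power2_eq_square fold, simp add: field_simps)
  have det1: "px * r + p * rx - 2 * q * qx = 0" "py * r + p * ry - 2 * q * qy = 0"
    and det2: "pxx * r + 2 * px * rx + p * rxx - 2 * qx * qx - 2 * q * qxx = 0"
      "pxy * r + px * ry + py * rx + p * rxy - 2 * qx * qy - 2 * q * qxy = 0"
      "pyy * r + 2 * py * ry + p * ryy - 2 * qy * qy - 2 * q * qyy = 0"
    using det_eqs by simp_all
  have S: "S z = px * rx - qx * qx + (py * ry - qy * qy)" by (simp add: S_def defs)
  have Sx: "px * rx - qx * qx = S z / 2" "py * ry - qy * qy = S z / 2"
    using xx by (simp_all add: S_def defs)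
  have F: "pxx + pyy + p * S z * k = 0" "qxx + qyy + q * S z * k = 0" "rxx + ryy + r * S z * k = 0"
    using harmonic[of P] harmonic[of Q] harmonic[of R]
    by (simp_all add: defs k_def divide_inverse)
  have W: "px * ry + py * rx - 2 * qx * qy = 0" using xy by (simp add: defs)
  have K: "k * k / 2 * (p * r - q * q) = k / 2"
  proof -
    have "p * r - q * q = \<delta>" using det by simp
    then show ?thesis using \<delta>_nz by (simp add: k_def field_simps)
  qed
  \<comment> \<open>This is \<open>log\<close> multiplied by - v^2 / 2 and simplified with u v =
    1.\<close>
  have L: "- v / 2 * (uxx + uyy) + v * v / 2 * (ux * ux + uy * uy) = - S z * k / 4"
  proof -
    define X Y where "X = uxx + uyy" and "Y = ux * ux + uy * uy"
    have "2 * (u * X - Y) = u * u * S z / \<delta>"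
      using log[folded defs] by (simp add: X_def Y_def)
    then have "2 * (u * X - Y) = u * u * S z * k"
      by (simp only: k_def divide_inverse)
    with u(2) have "- (2 * v * X) + 2 * v * v * Y = - (S z * k)" by algebra
    then show ?thesis by (simp flip: X_def Y_def)
  qed
  have nonplane: "ricci metric c c x = 0" "ricci metric c d x = 0" "ricci metric d c x = 0"
      "ricci metric d d x = 0"
    unfolding cc cd dc dd det1 S[symmetric] F by simp_all
  have mixed: "ricci metric a b x = 0" "ricci metric b a x = 0"
    unfolding ab ba det1 det2 W by simp_all
  have diag: "ricci metric a a x = 0" "ricci metric b b x = 0"
    unfolding aa bb det1 det2 K Sx L by simp_all
  \<comment> \<open>Each term contains a factor with an odd number of indices in {c, d} or a
    derivative along c or d.\<close>
  have cross: "ricci metric a c x = 0" "ricci metric a d x = 0" "ricci metric b c x = 0"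
    "ricci metric b d x = 0" "ricci metric c a x = 0" "ricci metric d a x = 0"
    "ricci metric c b x = 0" "ricci metric d b x = 0"
    by (simp add: ricci_metric[OF x] neq Gam_table dGam_def, simp add: table_defs)+
  have outside: "ricci metric i j x = 0" if "i \<notin> {a, b, c, d} \<or> j \<notin> {a, b, c, d}"
  proof -
    have "dGam j k i k (plane x) = 0" for k
      using that Gam_eq_0 dGam_eq_0 by auto
    then show ?thesis
      using that by (elim disjE) (simp_all add: ricci_metric[OF x] Gam_eq_0)
  qed
  show ?thesis
  proof (cases "i \<in> {a, b, c, d} \<and> j \<in> {a, b, c, d}")
    case True
    then show ?thesis using nonplane mixed diag cross by auto
  qed (use outside in auto)
qed

end

section \<open>Recovering the metric from its line element\<close>

context block_metric
begin

lemma sum_metric: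
  "(\<Sum>i\<in>UNIV. \<Sum>j\<in>UNIV. metric x $ i $ j * v $ i * v $ j) =
     jval (\<Psi> (plane x)) * ((v $ a)^2 + (v $ b)^2) + jval (P (plane x)) * (v $ c)^2
     + 2 * jval (Q (plane x)) * v $ c * v $ d + jval (R (plane x)) * (v $ d)^2
     + (\<Sum>k\<in>- {a, b, c, d}. e k * (v $ k)^2)"
proof -
  let ?z = "plane x"
  let ?r = "\<lambda>i. \<Sum>j\<in>UNIV. jval (entry i j ?z) * v $ i * v $ j"
  have single: "?r i = jval (entry i i ?z) * (v $ i)^2" if "i \<noteq> c" "i \<noteq> d" for i
  proof -
    have "?r i = (\<Sum>j\<in>{i}. jval (entry i j ?z) * v $ i * v $ j)"
      by (rule sum.mono_neutral_right) (use that in \<open>auto simp: entry_def jconst_def\<close>)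
    then show ?thesis by (simp add: power2_eq_square)
  qed
  have pair: "?r i = jval (entry i c ?z) * v $ i * v $ c + jval (entry i d ?z) * v $ i * v $ d"
    if "i = c \<or> i = d" for i
  proof -
    have "?r i = (\<Sum>j\<in>{c, d}. jval (entry i j ?z) * v $ i * v $ j)"
      by (rule sum.mono_neutral_right) (use that in \<open>auto simp: entry_def jconst_def\<close>)
    then show ?thesis using neq by simp
  qed
  have "(\<Sum>i\<in>UNIV. ?r i) = (\<Sum>i\<in>{a, b, c, d}. ?r i) + (\<Sum>i\<in>- {a, b, c, d}. ?r i)"
    using sum.union_disjoint[of "{a, b, c, d}" "- {a, b, c, d}" ?r] by (simp add: Compl_partition)
  also have "(\<Sum>i\<in>- {a, b, c, d}. ?r i) = (\<Sum>k\<in>- {a, b, c, d}. e k * (v $ k)^2)"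
    by (rule sum.cong) (auto simp: single, auto simp: entry_def jconst_def)
  also have "(\<Sum>i\<in>{a, b, c, d}. ?r i) =
      jval (\<Psi> ?z) * ((v $ a)^2 + (v $ b)^2) + jval (P ?z) * (v $ c)^2
     + 2 * jval (Q ?z) * v $ c * v $ d + jval (R ?z) * (v $ d)^2"
    using neq
    by (simp add: single pair)
      (simp add: entry_def jconst_def power2_eq_square algebra_simps)
  finally show ?thesis by (simp add: metric_def)
qed

text \<open>A symmetric matrix is determined by its quadratic form through polarization. The two
  families therefore have to be compared with the block metric only at the level of line
  elements.\<close>

lemma metric_of_eq:
  assumes "\<And>v. ds2 x v = jval (\<Psi> (plane x)) * ((v $ a)^2 + (v $ b)^2)
     + jval (P (plane x)) * (v $ c)^2
     + 2 * jval (Q (plane x)) * v $ c * v $ d + jval (R (plane x)) * (v $ d)^2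
     + (\<Sum>k\<in>- {a, b, c, d}. e k * (v $ k)^2)"
  shows "metric_of ds2 x = metric x"
proof -
  let ?B = "\<lambda>v w. \<Sum>i\<in>UNIV. \<Sum>j\<in>UNIV. metric x $ i $ j * v $ i * w $ j"
  have ds2: "ds2 x v = ?B v v" for v
    unfolding sum_metric by (rule assms)
  have B: "?B (axis k 1) (axis l 1) = metric x $ k $ l" for k l
  proof -
    have "?B (axis k 1) (axis l 1)
        = (\<Sum>i\<in>UNIV. \<Sum>j\<in>UNIV. if j = l then if i = k then metric x $ i $ j else 0 else 0)"
      by (intro sum.cong refl) (auto simp: axis_def)
    then show ?thesis by simp
  qed
  have polar: "?B (v + w) (v + w) - ?B v v - ?B w w = ?B v w + ?B w v" for v w
    by (simp add: algebra_simps sum.distrib)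
  have "ds2 x (axis k 1 + axis l 1) - ds2 x (axis k 1) - ds2 x (axis l 1)
      = 2 * metric x $ k $ l" for k l
  proof -
    have "ds2 x (axis k 1 + axis l 1) - ds2 x (axis k 1) - ds2 x (axis l 1)
        = ?B (axis k 1) (axis l 1) + ?B (axis l 1) (axis k 1)"
      unfolding ds2 by (rule polar)
    also have "\<dots> = metric x $ k $ l + metric x $ l $ k"
      by (simp only: B)
    also have "metric x $ l $ k = metric x $ k $ l"
      by (simp add: metric_def entry_sym[of l k])
    finally show ?thesis by simp
  qed
  then show ?thesis
    by (simp add: metric_of_def vec_eq_iff)
qed

end

section \<open>Locality of the vacuum equations\<close>

lemma has_derivative_cong_open:
  assumes "open S" "x \<in> S" "\<And>y. y \<in> S \<Longrightarrow> f y = g y"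
  shows "(f has_derivative D) (at x) \<longleftrightarrow> (g has_derivative D) (at x)"
proof
  show "(f has_derivative D) (at x) \<Longrightarrow> (g has_derivative D) (at x)"
    by (erule has_derivative_transform_within_open[OF _ assms(1,2)]) (simp add: assms(3))
  show "(g has_derivative D) (at x) \<Longrightarrow> (f has_derivative D) (at x)"
    by (erule has_derivative_transform_within_open[OF _ assms(1,2)]) (simp add: assms(3))
qed

text \<open>Both functions have exactly the same derivatives at \<open>x\<close>, so the choice
  operator in \<open>frechet_derivative\<close> returns the same map, even where there is
  none.\<close>

lemma pd_cong_open:
  assumes "open S" "x \<in> S" "\<And>y. y \<in> S \<Longrightarrow> f y = g y"
  shows "pd k f x = pd k g x"
proof -
  have "(f has_derivative D) (at x) \<longleftrightarrow> (g has_derivative D) (at x)" for D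
    by (rule has_derivative_cong_open[OF assms])
  then show ?thesis by (simp add: pd_def frechet_derivative_def)
qed

lemma differentiable_cong_open:
  assumes "open S" "x \<in> S" "\<And>y. y \<in> S \<Longrightarrow> f y = g y"
  shows "f differentiable at x \<longleftrightarrow> g differentiable at x"
proof -
  have "(f has_derivative D) (at x) \<longleftrightarrow> (g has_derivative D) (at x)" for D
    by (rule has_derivative_cong_open[OF assms])
  then show ?thesis by (simp add: differentiable_def)
qed

lemma C2_on_cong:
  assumes S: "open S" and fg: "\<And>y. y \<in> S \<Longrightarrow> f y = g y" and "C2_on S f"
  shows "C2_on S g"
proof -
  have p: "pd k g y = pd k f y" if "y \<in> S" for k y
    by (rule pd_cong_open[OF S that]) (simp add: fg)
  have pp: "pd l (pd k g) y = pd l (pd k f) y" if "y \<in> S" for k l y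
    by (rule pd_cong_open[OF S that p])
  have "g differentiable at y \<longleftrightarrow> f differentiable at y" if "y \<in> S" for y
    by (rule differentiable_cong_open[OF S that]) (simp add: fg)
  moreover have "pd k g differentiable at y \<longleftrightarrow> pd k f differentiable at y" if "y \<in> S" for k y
    by (rule differentiable_cong_open[OF S that p])
  moreover have "continuous_on S (pd l (pd k g)) \<longleftrightarrow> continuous_on S (pd l (pd k f))" for k l
    by (rule continuous_on_cong[OF refl pp])
  ultimately show ?thesis
    using assms(3) by (simp add: C2_on_def)
qed

text \<open>The Ricci tensor at a point depends only on the metric nearby. The transfer matters
  because the wave line element takes the block form only where \<open>Hfun H B (2 * n)\<close> is
  nonzero.\<close>

lemma solves_vacuum_einstein_on_cong:
  assumes gg': "\<And>x. x \<in> S \<Longrightarrow> g x = g' x" and sol: "solves_vacuum_einstein_on S g"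
  shows "solves_vacuum_einstein_on S g'"
proof -
  have S: "open S"
    using sol by (simp add: solves_vacuum_einstein_on_def pseudo_riemannian_metric_on_def)
  have p: "pd m (\<lambda>y. g' y $ i $ j) x = pd m (\<lambda>y. g y $ i $ j) x" if "x \<in> S" for m i j x
    by (rule pd_cong_open[OF S that]) (simp add: gg')
  have c: "christoffel g' k i j x = christoffel g k i j x" if "x \<in> S" for k i j x
    using that by (simp add: christoffel_def p gg')
  have "pd m (christoffel g' k i j) x = pd m (christoffel g k i j) x" if "x \<in> S" for m k i j x
    by (rule pd_cong_open[OF S that c])
  then have "ricci g' i j x = ricci g i j x" if "x \<in> S" for i j x
    using that by (simp add: ricci_def c)
  moreover have "C2_on S (\<lambda>x. g' x $ i $ j)" for i j
    by (rule C2_on_cong[OF S, of "\<lambda>x. g x $ i $ j"])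
      (use sol gg' in \<open>auto simp: solves_vacuum_einstein_on_def pseudo_riemannian_metric_on_def\<close>)
  ultimately show ?thesis
    using sol gg'
    by (simp add: solves_vacuum_einstein_on_def pseudo_riemannian_metric_on_def)
qed

section \<open>Jets of holomorphic functions\<close>

text \<open>For holomorphic f one has \<partial>_1 f = f' and \<partial>_2 f = i f'. The slots here
  and in \<open>im_jet\<close> are the real and imaginary parts of f, f', i f', f'', i f'', -f'';
  harmonicity is thus built in.\<close>

definition re_jet :: "(complex \<Rightarrow> complex) \<Rightarrow> complex \<Rightarrow> jet" where
  "re_jet f z = Jet (Re (f z)) (Re (deriv f z)) (- Im (deriv f z))
     (Re (deriv (deriv f) z)) (- Im (deriv (deriv f) z)) (- Re (deriv (deriv f) z))"

definition im_jet :: "(complex \<Rightarrow> complex) \<Rightarrow> complex \<Rightarrow> jet" where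
  "im_jet f z = Jet (Im (f z)) (Im (deriv f z)) (Re (deriv f z))
     (Im (deriv (deriv f) z)) (Re (deriv (deriv f) z)) (- Im (deriv (deriv f) z))"

lemma has_partials_Re_Im:
  assumes "(f has_field_derivative D) (at z)"
  shows "has_partials (\<lambda>w. Re (f w)) (Re D) (- Im D) z"
    and "has_partials (\<lambda>w. Im (f w)) (Im D) (Re D) z"
  using has_derivative_Re[OF assms[unfolded has_field_derivative_def]]
    has_derivative_Im[OF assms[unfolded has_field_derivative_def]]
  by (simp_all add: has_partials_def algebra_simps)

lemma has_partials_uminus:
  "has_partials f s t z \<Longrightarrow> has_partials (\<lambda>w. - f w) (- s) (- t) z"
  using has_partials_diff[OF has_partials_const[of 0]] by simp

lemma jet_on_re_im:
  assumes "open U" "f holomorphic_on U"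
  shows "jet_on U (re_jet f)" "jet_on U (im_jet f)"
proof -
  have f': "deriv f holomorphic_on U" and f'': "deriv (deriv f) holomorphic_on U"
    using assms by (auto intro: holomorphic_deriv)
  have d: "(f has_field_derivative deriv f z) (at z)"
    "(deriv f has_field_derivative deriv (deriv f) z) (at z)" if "z \<in> U" for z
    using holomorphic_derivI[OF assms(2,1) that] holomorphic_derivI[OF f' assms(1) that] by auto
  note [simp] = holomorphic_on_imp_continuous_on[OF f'']
  show "jet_on U (re_jet f)" "jet_on U (im_jet f)"
    unfolding jet_on_def re_jet_def im_jet_def jet.sel
    by (auto intro!: has_partials_uminus continuous_intros
        intro: has_partials_Re_Im d has_partials_eq_rhs[OF has_partials_uminus[OF has_partials_Re_Im(2)[OF d(2)]]])
qed

section \<open>The two families\<close>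

lemma (in block_metric) solves_vacuum_einstein:
  assumes "\<And>z J. z \<in> U \<Longrightarrow> J \<in> {P, Q, R} \<Longrightarrow>
      jdxx (J z) + jdyy (J z) = - jval (J z) * S z / \<delta>"
    and "\<And>z. z \<in> U \<Longrightarrow>
      jdx (P z) * jdy (R z) + jdy (P z) * jdx (R z) = 2 * jdx (Q z) * jdy (Q z)"
    and "\<And>z. z \<in> U \<Longrightarrow> jdx (P z) * jdx (R z) - jdx (Q z) * jdx (Q z)
           = jdy (P z) * jdy (R z) - jdy (Q z) * jdy (Q z)"
    and "\<And>z. z \<in> U \<Longrightarrow> jval (\<Psi> z) * (jdxx (\<Psi> z) + jdyy (\<Psi> z))
      - (jdx (\<Psi> z) * jdx (\<Psi> z) + jdy (\<Psi> z) * jdy (\<Psi> z))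
      = jval (\<Psi> z) * jval (\<Psi> z) * S z / (2 * \<delta>)"
  shows "solves_vacuum_einstein_on {x. plane x \<in> U} metric"
  unfolding solves_vacuum_einstein_on_def
  using pseudo_riemannian ricci_eq_0 assms by blast

definition norm2_jet :: "(complex \<Rightarrow> complex) \<Rightarrow> complex \<Rightarrow> jet" where
  "norm2_jet f z = jadd (jmul (re_jet f z) (re_jet f z)) (jmul (im_jet f z) (im_jet f z))"

lemma jet_on_norm2:
  "open U \<Longrightarrow> f holomorphic_on U \<Longrightarrow> jet_on U (norm2_jet f)"
  unfolding norm2_jet_def by (intro jet_on_add jet_on_mul jet_on_re_im)

lemma norm2_jet_val: "jval (norm2_jet f z) = Re (f z * cnj (f z))"
  by (simp add: norm2_jet_def jadd_def jmul_def re_jet_def im_jet_def)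

lemma norm2_jet_nonzero: "f z \<noteq> 0 \<Longrightarrow> jval (norm2_jet f z) \<noteq> 0"
  by (simp add: norm2_jet_def jadd_def jmul_def re_jet_def im_jet_def complex_eq_iff
      sum_squares_eq_zero_iff)

text \<open>For u = |f|^2 the left side stands for u^2 \<Delta> ln u. It vanishes because u
  \<Delta>u and |\<nabla>u|^2 both equal 4 |f|^2 |f'|^2, a formal identity in f, f' and f''.\<close>

lemma log_norm2_harmonic:
  "jval (norm2_jet f z) * (jdxx (norm2_jet f z) + jdyy (norm2_jet f z))
   - (jdx (norm2_jet f z) * jdx (norm2_jet f z) + jdy (norm2_jet f z) * jdy (norm2_jet f z)) = 0"
  by (simp add: norm2_jet_def jadd_def jmul_def re_jet_def im_jet_def algebra_simps)

lemma jet_eqI: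
  assumes "jval F = jval G" "jdx F = jdx G" "jdy F = jdy G"
    "jdxx F = jdxx G" "jdxy F = jdxy G" "jdyy F = jdyy G"
  shows "F = G"
  using assms by (cases F; cases G) simp

lemma jinv_mult: "jval F \<noteq> 0 \<Longrightarrow> jmul F (jinv F) = jconst 1"
  by (rule jet_eqI)
    (simp_all add: jmul_def jinv_def jconst_def Let_def field_simps power2_eq_square power3_eq_cube)

text \<open>Intended for s = (-1)^n, \<open>f\<close> = \<open>Fodd H B n\<close> and
  \<open>g\<close> = \<open>Efun H B (2 * n)\<close>.\<close>

locale pp_wave =
  fixes a b c d :: "'n::finite" and e :: "'n \<Rightarrow> real" and s :: real and U :: "complex set"
    and f g :: "complex \<Rightarrow> complex"
  assumes distinct: "distinct [a, b, c, d]" and e: "\<And>i. e i \<noteq> 0" and s: "s * s = 1"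
    and U: "open U" and f: "f holomorphic_on U" "\<And>z. z \<in> U \<Longrightarrow> f z \<noteq> 0"
    and g: "g holomorphic_on U"
begin

text \<open>With h = Re g, expanding the square in the wave line element gives P = s (2 - h), Q = h
  - 1, R = - s h. The determinant is - h (2 - h) - (h - 1)^2 = -1, so the block always contains one
  time direction.\<close>

sublocale block_metric a b c d e "- 1" U "norm2_jet f"
  "\<lambda>z. jmul (jconst s) (jadd (jconst 2) (jmul (jconst (- 1)) (re_jet g z)))"
  "\<lambda>z. jadd (re_jet g z) (jconst (- 1))"
  "\<lambda>z. jmul (jconst (- s)) (re_jet g z)"
proof
  show "jmul (jmul (jconst s) (jadd (jconst 2) (jmul (jconst (- 1)) (re_jet g z))))
          (jmul (jconst (- s)) (re_jet g z))
      = jadd (jmul (jadd (re_jet g z) (jconst (- 1))) (jadd (re_jet g z) (jconst (- 1))))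
          (jconst (- 1))" for z
  proof -
    have s': "s * (s * t) = t" for t using s by (simp flip: mult.assoc)
    show ?thesis
      by (rule jet_eqI) (simp_all add: jmul_def jadd_def jconst_def algebra_simps s s')
  qed
qed (use distinct e U f g in
    \<open>auto intro!: jet_on_norm2 jet_on_mul jet_on_add jet_on_const jet_on_re_im simp: norm2_jet_nonzero\<close>)

text \<open>The block is a constant matrix plus h times a constant matrix of determinant s^2 - 1 =
  0.\<close>

lemma S_eq_0: "S z = 0"
  unfolding S_def using s
  by (simp add: jadd_def jmul_def jconst_def re_jet_def algebra_simps) (simp flip: mult.assoc)

lemma solves_vacuum: "solves_vacuum_einstein_on {x. plane x \<in> U} metric"
proof (rule solves_vacuum_einstein)
  show "jdxx (J z) + jdyy (J z) = - jval (J z) * S z / - 1"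
    if "J \<in> {\<lambda>z. jmul (jconst s) (jadd (jconst 2) (jmul (jconst (- 1)) (re_jet g z))),
      \<lambda>z. jadd (re_jet g z) (jconst (- 1)), \<lambda>z. jmul (jconst (- s)) (re_jet g z)}" for z J
    using that unfolding S_eq_0 insert_iff empty_iff
    by (elim disjE FalseE) (simp_all add: jadd_def jmul_def jconst_def re_jet_def)
next
  have s': "s * (s * t) = t" for t using s by (simp flip: mult.assoc)
  fix z
  show "jdx (jmul (jconst s) (jadd (jconst 2) (jmul (jconst (- 1)) (re_jet g z)))) *
      jdy (jmul (jconst (- s)) (re_jet g z)) +
      jdy (jmul (jconst s) (jadd (jconst 2) (jmul (jconst (- 1)) (re_jet g z)))) *
      jdx (jmul (jconst (- s)) (re_jet g z)) =
      2 * jdx (jadd (re_jet g z) (jconst (- 1))) * jdy (jadd (re_jet g z) (jconst (- 1)))"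
    "jdx (jmul (jconst s) (jadd (jconst 2) (jmul (jconst (- 1)) (re_jet g z)))) *
      jdx (jmul (jconst (- s)) (re_jet g z)) -
      jdx (jadd (re_jet g z) (jconst (- 1))) * jdx (jadd (re_jet g z) (jconst (- 1))) =
      jdy (jmul (jconst s) (jadd (jconst 2) (jmul (jconst (- 1)) (re_jet g z)))) *
      jdy (jmul (jconst (- s)) (re_jet g z)) -
      jdy (jadd (re_jet g z) (jconst (- 1))) * jdy (jadd (re_jet g z) (jconst (- 1)))"
    by (simp_all add: jadd_def jmul_def jconst_def re_jet_def algebra_simps s')
qed (simp_all add: S_eq_0 log_norm2_harmonic)

end

text \<open>Intended for s = (-1)^n, \<open>f\<close> = \<open>Fodd H B n\<close> and
  \<open>g\<close> = \<open>Efun H B (2 * n + 1)\<close>.\<close>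

locale gibbons_hawking =
  fixes a b c d :: "'n::finite" and e :: "'n \<Rightarrow> real" and s :: real and U :: "complex set"
    and f g :: "complex \<Rightarrow> complex"
  assumes distinct: "distinct [a, b, c, d]" and e: "\<And>i. e i \<noteq> 0" and s: "s * s = 1"
    and U: "open U" and f: "f holomorphic_on U" "\<And>z. z \<in> U \<Longrightarrow> f z \<noteq> 0"
    and g: "g holomorphic_on U" "\<And>z. z \<in> U \<Longrightarrow> Re (g z) \<noteq> 0"
begin

text \<open>With g = h + i b, y = dx^c and w = dx^d, the block is h y^2 + (w - s b y)^2 / h = |w -
  \<tau> y|^2 / h for \<tau> = s b + i h. This \<tau> is antiholomorphic in z for s = 1 and
  holomorphic for s = -1, hence harmonic and conformal for the hyperbolic metric, which explains the
  field equations.\<close>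

sublocale block_metric a b c d e 1 U "\<lambda>z. jmul (norm2_jet f z) (re_jet g z)"
  "\<lambda>z. jadd (re_jet g z) (jmul (jmul (im_jet g z) (im_jet g z)) (jinv (re_jet g z)))"
  "\<lambda>z. jmul (jconst (- s)) (jmul (im_jet g z) (jinv (re_jet g z)))"
  "\<lambda>z. jinv (re_jet g z)"
proof
  show "jmul (jadd (re_jet g z) (jmul (jmul (im_jet g z) (im_jet g z)) (jinv (re_jet g z))))
          (jinv (re_jet g z))
      = jadd (jmul (jmul (jconst (- s)) (jmul (im_jet g z) (jinv (re_jet g z))))
          (jmul (jconst (- s)) (jmul (im_jet g z) (jinv (re_jet g z))))) (jconst 1)"
    if "z \<in> U" for z
  proof -
    \<comment> \<open>With k the jet of b / h, one has P R = k k + h (1 / h), and the factor - s of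
      Q squares to one.\<close>
    define h k where "h = re_jet g z" and "k = jmul (im_jet g z) (jinv (re_jet g z))"
    have s': "s * (s * t) = t" for t using s by (simp flip: mult.assoc)
    have "jval h \<noteq> 0" using g(2)[OF that] by (simp add: h_def re_jet_def)
    have "jmul (jadd h (jmul (jmul (im_jet g z) (im_jet g z)) (jinv h))) (jinv h)
        = jadd (jmul k k) (jmul h (jinv h))"
      by (rule jet_eqI) (simp_all add: k_def h_def[symmetric] jadd_def jmul_def algebra_simps)
    also have "jmul h (jinv h) = jconst 1" by (rule jinv_mult) fact
    also have "jmul k k = jmul (jmul (jconst (- s)) k) (jmul (jconst (- s)) k)"
      by (rule jet_eqI) (simp_all add: jmul_def jconst_def algebra_simps s')
    finally show ?thesis unfolding h_def k_def .
  qed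
  show "jval (jmul (norm2_jet f z) (re_jet g z)) \<noteq> 0" if "z \<in> U" for z
    using norm2_jet_nonzero[of f z] f(2) g(2) that by (simp add: jmul_def re_jet_def)
  have inv: "jet_on U (\<lambda>z. jinv (re_jet g z))"
    by (rule jet_on_inv[OF jet_on_re_im(1)[OF U g(1)]]) (simp add: re_jet_def g(2))
  show "jet_on U (\<lambda>z. jmul (norm2_jet f z) (re_jet g z))" "jet_on U (\<lambda>z. jinv (re_jet g z))"
    "jet_on U (\<lambda>z. jadd (re_jet g z) (jmul (jmul (im_jet g z) (im_jet g z)) (jinv (re_jet g z))))"
    "jet_on U (\<lambda>z. jmul (jconst (- s)) (jmul (im_jet g z) (jinv (re_jet g z))))"
    by (intro jet_on_norm2 jet_on_mul jet_on_add jet_on_const jet_on_re_im inv U f g)+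
qed (use distinct e U in auto)

lemma solves_vacuum: "solves_vacuum_einstein_on {x. plane x \<in> U} metric"
proof (rule solves_vacuum_einstein)
  fix z assume z: "z \<in> U"
  \<comment> \<open>In this proof \<open>b\<close>, \<open>c\<close>, \<open>d\<close> are numbers
    that hide the indices of the locale: at z, g = h + i b, g' = c + i d and g'' = u + i v.\<close>
  define h b c d u v where "h = Re (g z)" and "b = Im (g z)" and "c = Re (deriv g z)"
    and "d = Im (deriv g z)" and "u = Re (deriv (deriv g) z)" and "v = Im (deriv (deriv g) z)"
  note defs = this
  have h: "h \<noteq> 0" using g(2)[OF z] by (simp add: defs)
  have s': "s * (s * t) = t" for t using s by (simp flip: mult.assoc)
  have re: "re_jet g z = Jet h c (- d) u (- v) (- u)" and im: "im_jet g z = Jet b d c v u (- v)"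
    by (simp_all add: re_jet_def im_jet_def defs)
  \<comment> \<open>With \<open>k\<close> as an atom, the checks below are polynomial computations
    modulo h k = 1 and s^2 = 1.\<close>
  define k where "k = inverse h"
  have k: "h * k = 1" "h * (k * t) = t" for t using h by (simp_all add: k_def)
  have inv: "jinv (Jet h c (- d) u (- v) (- u)) = Jet k (- c * (k * k)) (d * (k * k))
      (2 * c * c * (k * k * k) - u * (k * k)) (- 2 * c * d * (k * k * k) + v * (k * k))
      (2 * d * d * (k * k * k) + u * (k * k))"
    unfolding jinv_def Let_def jet.sel k_def
    by (simp add: divide_simps h power2_eq_square power3_eq_cube)
  note unfold = inv re im jadd_def jmul_def jconst_def jet.sel
  have S: "S z = - 2 * (c * c + d * d) * (k * k)"
    unfolding S_def unfolding unfold
    by (simp add: algebra_simps s s')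
  show "jdx (jadd (re_jet g z) (jmul (jmul (im_jet g z) (im_jet g z)) (jinv (re_jet g z)))) *
        jdy (jinv (re_jet g z)) +
        jdy (jadd (re_jet g z) (jmul (jmul (im_jet g z) (im_jet g z)) (jinv (re_jet g z)))) *
        jdx (jinv (re_jet g z)) =
      2 * jdx (jmul (jconst (- s)) (jmul (im_jet g z) (jinv (re_jet g z)))) *
        jdy (jmul (jconst (- s)) (jmul (im_jet g z) (jinv (re_jet g z))))"
    unfolding unfold
    by (simp add: algebra_simps s s')
  show "jdx (jadd (re_jet g z) (jmul (jmul (im_jet g z) (im_jet g z)) (jinv (re_jet g z)))) *
        jdx (jinv (re_jet g z)) -
        jdx (jmul (jconst (- s)) (jmul (im_jet g z) (jinv (re_jet g z)))) *
        jdx (jmul (jconst (- s)) (jmul (im_jet g z) (jinv (re_jet g z)))) =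
      jdy (jadd (re_jet g z) (jmul (jmul (im_jet g z) (im_jet g z)) (jinv (re_jet g z)))) *
        jdy (jinv (re_jet g z)) -
        jdy (jmul (jconst (- s)) (jmul (im_jet g z) (jinv (re_jet g z)))) *
        jdy (jmul (jconst (- s)) (jmul (im_jet g z) (jinv (re_jet g z))))"
    unfolding unfold
    by (simp add: algebra_simps s s')
  show "jdxx (J z) + jdyy (J z) = - jval (J z) * S z / 1"
    if "J \<in> {\<lambda>z. jadd (re_jet g z) (jmul (jmul (im_jet g z) (im_jet g z)) (jinv (re_jet g z))),
      \<lambda>z. jmul (jconst (- s)) (jmul (im_jet g z) (jinv (re_jet g z))),
      \<lambda>z. jinv (re_jet g z)}" for J
    using that unfolding S insert_iff empty_iff
    by (elim disjE FalseE) (simp_all add: unfold algebra_simps k)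
  \<comment> \<open>As \<Psi> = N h and \<Delta>h = 0, the expression splits into h^2 times the same
    expression for N, which vanishes, and - N^2 |\<nabla>h|^2, which equals N^2 h^2 S / 2.\<close>
  let ?N = "norm2_jet f z"
  let ?F = "jmul ?N (re_jet g z)"
  have "jval ?F * (jdxx ?F + jdyy ?F) - (jdx ?F * jdx ?F + jdy ?F * jdy ?F)
      = h * h * (jval ?N * (jdxx ?N + jdyy ?N) - (jdx ?N * jdx ?N + jdy ?N * jdy ?N))
        - jval ?N * jval ?N * (c * c + d * d)"
    unfolding jmul_def jet.sel re by (simp add: algebra_simps)
  also have "\<dots> = jval ?F * jval ?F * S z / (2 * 1)"
    unfolding S log_norm2_harmonic unfolding jmul_def jet.sel re
    by (simp add: algebra_simps k)
  finally show "jval ?F * (jdxx ?F + jdyy ?F) - (jdx ?F * jdx ?F + jdy ?F * jdy ?F)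
      = jval ?F * jval ?F * S z / (2 * 1)" .
qed

end

section \<open>Holomorphy of the recursively defined functions\<close>

lemma Efun_1_holomorphic:
  assumes "open U" "conjugate_harmonic_on U H B"
  shows "Efun H B (Suc 0) holomorphic_on U"
proof -
  \<comment> \<open>The conjugacy relations are the Cauchy-Riemann equations: they make the real
    derivative of H + i B complex linear, namely multiplication by \<partial>_1 H + i \<partial>_1
    B.\<close>
  have "(Efun H B (Suc 0) has_field_derivative
      Complex (frechet_derivative H (at z) 1) (frechet_derivative B (at z) 1)) (at z)"
    if z: "z \<in> U" for z
  proof -
    let ?H = "frechet_derivative H (at z)" and ?B = "frechet_derivative B (at z)"
    have d: "(H has_derivative ?H) (at z)" "(B has_derivative ?B) (at z)"
      and cr: "?B \<i> = ?H 1" "?H \<i> = - ?B 1"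
      using assms(2) z by (auto simp: conjugate_harmonic_on_def frechet_derivative_works)
    have lin: "L w = Re w * L 1 + Im w * L \<i>" if "linear L" for L :: "complex \<Rightarrow> real" and w
    proof -
      have "L w = L (Re w *\<^sub>R 1 + Im w *\<^sub>R \<i>)"
        by (rule arg_cong[of _ _ L]) (simp add: complex_eq_iff)
      then show ?thesis
        using that by (simp add: linear_add linear_scale)
    qed
    have "((\<lambda>w. complex_of_real (H w) + \<i> * complex_of_real (B w)) has_derivative
        (\<lambda>w. complex_of_real (?H w) + \<i> * complex_of_real (?B w))) (at z)"
      by (intro derivative_intros d)
    moreover have "complex_of_real (?H w) + \<i> * complex_of_real (?B w)
        = Complex (?H 1) (?B 1) * w" for w
      using lin[OF has_derivative_linear[OF d(1)], of w]
        lin[OF has_derivative_linear[OF d(2)], of w] cr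
      by (simp add: complex_eq_iff)
    moreover have "Efun H B (Suc 0) = (\<lambda>w. complex_of_real (H w) + \<i> * complex_of_real (B w))"
      by (rule ext) simp
    ultimately show ?thesis
      by (simp add: has_field_derivative_def)
  qed
  then show ?thesis
    using assms(1) holomorphic_on_open by blast
qed

text \<open>Indexing by \<open>Suc m\<close> avoids the unspecified index 0. The recursion takes
  reciprocals of predecessors, so nonvanishing is asked for up to \<open>m\<close>, one below the
  index in the conclusion.\<close>

lemma Efun_holomorphic:
  assumes "open U" "conjugate_harmonic_on U H B"
    and "\<And>z q. z \<in> U \<Longrightarrow> 1 \<le> q \<Longrightarrow> q \<le> m \<Longrightarrow> Efun H B q z \<noteq> 0"
  shows "Efun H B (Suc m) holomorphic_on U"
  using assms(3)
proof (induction m)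
  case 0
  show ?case by (rule Efun_1_holomorphic[OF assms(1,2)])
next
  case (Suc m)
  have h: "Efun H B (Suc m) holomorphic_on U" by (rule Suc.IH) (simp add: Suc.prems)
  have "Efun H B (Suc (Suc m)) =
      (if even m then (\<lambda>z. 1 / Efun H B (Suc m) z) else (\<lambda>z. 2 - Efun H B (Suc m) z))"
    by (auto simp: fun_eq_iff)
  moreover have "Efun H B (Suc m) z \<noteq> 0" if "z \<in> U" for z
    using Suc.prems[OF that, of "Suc m"] by simp
  ultimately show ?case
    using h by (auto intro!: holomorphic_intros)
qed

lemma Fodd_holomorphic:
  assumes "open U" "conjugate_harmonic_on U H B"
    and nz: "\<And>z q. z \<in> U \<Longrightarrow> 1 \<le> q \<Longrightarrow> q \<le> 2 * n \<Longrightarrow> Efun H B q z \<noteq> 0"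
  shows "Fodd H B n holomorphic_on U" and "z \<in> U \<Longrightarrow> Fodd H B n z \<noteq> 0"
proof -
  have "Efun H B (2 * k - 1) holomorphic_on U" if "k \<in> {1..n}" for k
  proof -
    \<comment> \<open>Since k is at least 1, the natural-number subtraction is genuine; nonvanishing
      is used up to index 2 k - 2, which is below 2 n.\<close>
    have "Efun H B (Suc (2 * k - 2)) holomorphic_on U"
      by (rule Efun_holomorphic[OF assms(1,2)]) (use that nz in auto)
    moreover have "Suc (2 * k - 2) = 2 * k - 1" using that by auto
    ultimately show ?thesis by simp
  qed
  then show "Fodd H B n holomorphic_on U"
    unfolding Fodd_def[abs_def] by (auto intro!: holomorphic_intros)
  show "Fodd H B n z \<noteq> 0" if "z \<in> U"
    using nz[OF that] by (auto simp: Fodd_def)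
qed

section \<open>Identification with the eleven-dimensional line elements\<close>

lemma UNIV_11: "(UNIV :: 11 set) = {1, 2, 3, 4, 5, 6, 7, 8, 9, 10, 11}"
  \<comment> \<open>Counting: the numerals are eleven distinct elements of a type with eleven
    elements.\<close>
  by (rule sym, rule card_subset_eq) simp_all

lemma transverse_indices: "- {1, 2, 3, 11 :: 11} = {4, 5, 6, 7, 8, 9, 10}"
proof -
  have "- {1, 2, 3, 11 :: 11} = UNIV - {1, 2, 3, 11}" by (rule Compl_eq_Diff_UNIV)
  then show ?thesis unfolding UNIV_11 by (simp add: insert_Diff_if)
qed

lemma kk_wave_vacuum:
  assumes U: "open U" and HB: "conjugate_harmonic_on U H B" and n: "n > 0"
    and nz: "\<And>z p. z \<in> U \<Longrightarrow> 1 \<le> p \<Longrightarrow> p \<le> 2 * n \<Longrightarrow> Efun H B p z \<noteq> 0"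
    and pos: "\<And>z. z \<in> U \<Longrightarrow> Hfun H B (2 * n) z > 0"
  shows "solves_vacuum_einstein_on {x. plane_point x \<in> U} (metric_of (kk_wave_ds2 H B n))"
proof -
  define s :: real where "s = (-1)^n"
  have s: "s * s = 1" by (simp add: s_def flip: power_mult_distrib)
  \<comment> \<open>Positivity of \<open>n\<close> makes 2 n a successor, as
    \<open>Efun_holomorphic\<close> requires.\<close>
  have "Efun H B (Suc (2 * n - 1)) holomorphic_on U"
    by (rule Efun_holomorphic[OF U HB]) (use nz in auto)
  then have hol: "Efun H B (2 * n) holomorphic_on U" using n by simp
  interpret pp_wave "1 :: 11" 2 3 11 "\<lambda>_. 1" s U "Fodd H B n" "Efun H B (2 * n)"
    by unfold_locales
      (use U hol s Fodd_holomorphic[OF U HB nz] in \<open>simp_all\<close>)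
  have plane: "plane = plane_point"
    by (simp add: fun_eq_iff plane_def plane_point_def)
  show ?thesis
  proof (rule solves_vacuum_einstein_on_cong[OF _ solves_vacuum[unfolded plane]])
    fix x assume "x \<in> {x. plane_point x \<in> U}"
    then have h: "Hfun H B (2 * n) (plane_point x) \<noteq> 0" using pos[of "plane_point x"] by simp
    show "metric x = metric_of (kk_wave_ds2 H B n) x"
    proof (rule metric_of_eq[symmetric], unfold transverse_indices plane)
      fix v :: "real^11"
      let ?z = "plane_point x"
      define h y w where "h = Hfun H B (2 * n) ?z" and "y = v $ 3" and "w = v $ 11"
      have s': "s * (s * t) = t" for t using s by (simp flip: mult.assoc)
      \<comment> \<open>Here s^2 = 1 and h is nonzero; the coefficient of y^2 is s / h - s h (1 - 1
        / h)^2 = s (2 - h).\<close>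
      have "s * inverse h * y^2 + - s * h * (w - (- s * inverse h + s) * y)^2
          = s * (2 - h) * y^2 + 2 * (h - 1) * y * w + - s * h * w^2"
        using h unfolding h_def[symmetric]
        by (simp add: field_simps power2_eq_square s s')
      then show "kk_wave_ds2 H B n x v =
         jval (norm2_jet (Fodd H B n) ?z) * ((v $ 1)\<^sup>2 + (v $ 2)\<^sup>2)
         + jval (jmul (jconst s) (jadd (jconst 2) (jmul (jconst (- 1)) (re_jet (Efun H B (2 * n)) ?z))))
           * (v $ 3)\<^sup>2
         + 2 * jval (jadd (re_jet (Efun H B (2 * n)) ?z) (jconst (- 1))) * v $ 3 * v $ 11
         + jval (jmul (jconst (- s)) (re_jet (Efun H B (2 * n)) ?z)) * (v $ 11)\<^sup>2
         + (\<Sum>k\<in>{4, 5, 6, 7, 8, 9, 10}. 1 * (v $ k)\<^sup>2)"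
        unfolding kk_wave_ds2_def Let_def norm2_jet_val power_add power_one_right
          s_def[symmetric] h_def[symmetric] y_def[symmetric] w_def[symmetric]
        by (simp add: jadd_def jmul_def jconst_def re_jet_def flip: Hfun_def h_def)
    qed
  qed
qed

lemma kk_monopole_vacuum:
  assumes U: "open U" and HB: "conjugate_harmonic_on U H B"
    and nz: "\<And>z p. z \<in> U \<Longrightarrow> 1 \<le> p \<Longrightarrow> p \<le> 2 * n + 1 \<Longrightarrow> Efun H B p z \<noteq> 0"
    and pos: "\<And>z. z \<in> U \<Longrightarrow> Hfun H B (2 * n + 1) z > 0"
  shows "solves_vacuum_einstein_on {x. plane_point x \<in> U} (metric_of (kk_monopole_ds2 H B n))"
proof -
  define s :: real where "s = (-1)^n"
  \<comment> \<open>The constants of the transverse directions absorb the two opposite signs of the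
    flat part.\<close>
  define e :: "11 \<Rightarrow> real" where "e k = (if k \<in> {9, 10} then - s else s)" for k
  have s: "s * s = 1" by (simp add: s_def flip: power_mult_distrib)
  have e: "e k \<noteq> 0" for k by (simp add: e_def s_def)
  have "Efun H B (Suc (2 * n)) holomorphic_on U"
    by (rule Efun_holomorphic[OF U HB]) (use nz in auto)
  then have hol: "Efun H B (2 * n + 1) holomorphic_on U" by simp
  have nz': "Efun H B p z \<noteq> 0" if "z \<in> U" "1 \<le> p" "p \<le> 2 * n" for z p
    by (rule nz) (use that in auto)
  have nzre: "Re (Efun H B (2 * n + 1) z) \<noteq> 0" if "z \<in> U" for z
    using pos[OF that] by (simp add: Hfun_def)
  interpret gibbons_hawking "1 :: 11" 2 3 11 e s U "Fodd H B n" "Efun H B (2 * n + 1)"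
    by unfold_locales
      (use U hol s e nzre Fodd_holomorphic[OF U HB nz'] in \<open>simp_all\<close>)
  have plane: "plane = plane_point"
    by (simp add: fun_eq_iff plane_def plane_point_def)
  show ?thesis
  proof (rule solves_vacuum_einstein_on_cong[OF _ solves_vacuum[unfolded plane]])
    fix x assume "x \<in> {x. plane_point x \<in> U}"
    then have h: "Hfun H B (2 * n + 1) (plane_point x) \<noteq> 0" using pos[of "plane_point x"] by simp
    show "metric x = metric_of (kk_monopole_ds2 H B n) x"
    proof (rule metric_of_eq[symmetric], unfold transverse_indices plane)
      fix v :: "real^11"
      let ?z = "plane_point x" and ?E = "Efun H B (2 * n + 1)"
      define h b y w where "h = Hfun H B (2 * n + 1) ?z" and "b = Bfun H B (2 * n + 1) ?z"
        and "y = v $ 3" and "w = v $ 11"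
      have s': "s * (s * t) = t" for t using s by (simp flip: mult.assoc)
      \<comment> \<open>Since s^2 = 1, the square contributes b^2 / h to the coefficient of y^2,
        while the sign s survives in the cross term.\<close>
      have quad: "h * y^2 + inverse h * (w - s * b * y)^2
          = (h + b * b * inverse h) * y^2 + 2 * (- s * (b * inverse h)) * y * w + inverse h * w^2"
        by (simp add: algebra_simps power2_eq_square s s')
      have flat: "(\<Sum>k\<in>{4, 5, 6, 7, 8, 9, 10}. e k * (v $ k)\<^sup>2)
          = s * (\<Sum>k\<in>{4, 5, 6, 7, 8}. (v $ k)\<^sup>2) + - s * ((v $ 9)\<^sup>2 + (v $ 10)\<^sup>2)"
        by (simp add: e_def algebra_simps)
      have jets: "jval (re_jet ?E ?z) = h" "jval (im_jet ?E ?z) = b"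
        by (simp_all add: re_jet_def im_jet_def h_def b_def Hfun_def Bfun_def)
      have "kk_monopole_ds2 H B n x v =
         jval (norm2_jet (Fodd H B n) ?z) * h * ((v $ 1)\<^sup>2 + (v $ 2)\<^sup>2)
         + (h * y^2 + inverse h * (w - s * b * y)^2)
         + (s * (\<Sum>k\<in>{4, 5, 6, 7, 8}. (v $ k)\<^sup>2) + - s * ((v $ 9)\<^sup>2 + (v $ 10)\<^sup>2))"
        unfolding kk_monopole_ds2_def Let_def norm2_jet_val power_add power_one_right
          s_def[symmetric] h_def[symmetric] b_def[symmetric] y_def[symmetric] w_def[symmetric]
        by simp
      then show "kk_monopole_ds2 H B n x v =
         jval (jmul (norm2_jet (Fodd H B n) ?z) (re_jet ?E ?z)) * ((v $ 1)\<^sup>2 + (v $ 2)\<^sup>2)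
         + jval (jadd (re_jet ?E ?z) (jmul (jmul (im_jet ?E ?z) (im_jet ?E ?z)) (jinv (re_jet ?E ?z))))
           * (v $ 3)\<^sup>2
         + 2 * jval (jmul (jconst (- s)) (jmul (im_jet ?E ?z) (jinv (re_jet ?E ?z)))) * v $ 3 * v $ 11
         + jval (jinv (re_jet ?E ?z)) * (v $ 11)\<^sup>2
         + (\<Sum>k\<in>{4, 5, 6, 7, 8, 9, 10}. e k * (v $ k)\<^sup>2)"
        unfolding quad flat
        by (simp add: jadd_def jmul_def jconst_def jinv_def Let_def jets[simplified] y_def w_def)
    qed
  qed
qed

theorem mainTheorem5:
  fixes H B :: "complex \<Rightarrow> real" and U :: "complex set"
  assumes "open U"
    and "conjugate_harmonic_on U H B"
  shows
    "(\<forall>n::nat. n > 0 \<longrightarrow>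
        (\<forall>z\<in>U. (\<forall>p\<in>{1..2*n}. Efun H B p z \<noteq> 0) \<and> Hfun H B (2*n) z > 0) \<longrightarrow>
        solves_vacuum_einstein_on {x. plane_point x \<in> U} (metric_of (kk_wave_ds2 H B n))) \<and>
     (\<forall>n::nat.
        (\<forall>z\<in>U. (\<forall>p\<in>{1..2*n+1}. Efun H B p z \<noteq> 0) \<and> Hfun H B (2*n+1) z > 0) \<longrightarrow>
        solves_vacuum_einstein_on {x. plane_point x \<in> U} (metric_of (kk_monopole_ds2 H B n)))"
  using kk_wave_vacuum[OF assms] kk_monopole_vacuum[OF assms] by simp

end
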